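(* Let $H\in\mathbb{C}^{n\times n}$ be an invertible Hermitian matrix and let $B\in\mathbb{C}^{n\times n}$ be an $H$-nonnegative matrix. Then $B$ has an $H$-selfadjoint square root if and only if $B$ satisfies the following: (i) $B$ has no negative eigenvalues, that is, $\sigma(B)\subset[0,\infty)$; (ii) at the eigenvalue zero of $B$, the number of Jordan blocks of size one with positive sign characteristic is not less than the number of Jordan blocks of size two, i.e. $s_+\ge t$.
   Context: With $(\cdot,\cdot)$ the Euclidean inner product on $\mathbb{C}^n$ and $[x,y]=(Hx,y)$: a matrix $B$ is $H$-nonnegative if $[Bx,x]\ge 0$ for all $x\in\mathbb{C}^n$, and a matrix $A$ is $H$-selfadjoint if $HA=A^*H$. An $H$-selfadjoint square root of $B$ is an $H$-selfadjoint $A\in\mathbb{C}^{n\times n}$ with $A^2=B$. $J_k(\lambda)$ is the $k\times k$ Jordan block with eigenvalue $\lambda$; $Q_k$ is the $k\times k$ matrix with ones on the main anti-diagonal and zeros elsewhere. For every $H$-nonnegative $B$ there is an invertible $S$ such that $$S^{-1}BS=\bigoplus_{i=1}^qJ_1(\lambda_i)\oplus\bigoplus_{i=1}^{r-q}J_1(\lambda_{q+i})\oplus\bigoplus_{i=1}^sJ_1(0)\oplus\bigoplus_{i=1}^tJ_2(0),$$ $$S^*HS=\bigoplus_{i=1}^qQ_1\oplus\bigoplus_{i=1}^{r-q}(-Q_1)\oplus\bigoplus_{i=1}^s\varepsilon_iQ_1\oplus\bigoplus_{i=1}^tQ_2,$$ with $\lambda_1,\ldots,\lambda_q>0$, $\lambda_{q+1},\ldots,\lambda_r<0$,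 $\varepsilon_i=\pm1$. This canonical form is unique up to simultaneous permutation of blocks. The $i$-th block $J_1(0)$ has positive (negative) sign characteristic if $\varepsilon_i=1$ ($\varepsilon_i=-1$); $s_+$ is the number of $i$ with $\varepsilon_i=1$, and $t$ is the number of blocks $J_2(0)$. *)

theory Defs
  imports
    "Jordan_Normal_Form.Schur_Decomposition"
    "Jordan_Normal_Form.Jordan_Normal_Form"
    "Jordan_Normal_Form.Spectral_Radius"
begin

definition indef_inner :: "complex mat \<Rightarrow> complex vec \<Rightarrow> complex vec \<Rightarrow> complex" where
  "indef_inner H x y = (H *\<^sub>v x) \<bullet>c y"

text \<open>The order on \<^typ>\<open>complex\<close> is that of \<^theory>\<open>HOL-Library.Complex_Order\<close>:
  \<open>0 \<le> z\<close> means that \<open>z\<close> is real and nonnegative.\<close>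

definition H_nonnegative :: "complex mat \<Rightarrow> complex mat \<Rightarrow> bool" where
  "H_nonnegative H B \<longleftrightarrow>
     (\<forall>x \<in> carrier_vec (dim_row H). indef_inner H (B *\<^sub>v x) x \<ge> 0)"

definition H_selfadjoint :: "complex mat \<Rightarrow> complex mat \<Rightarrow> bool" where
  "H_selfadjoint H A \<longleftrightarrow> H * A = mat_adjoint A * H"

definition H_selfadjoint_sqrt :: "complex mat \<Rightarrow> complex mat \<Rightarrow> complex mat \<Rightarrow> bool" where
  "H_selfadjoint_sqrt H B A \<longleftrightarrow>
     A \<in> carrier_mat (dim_row B) (dim_row B) \<and> H_selfadjoint H A \<and> A * A = B"

definition sip_mat :: "nat \<Rightarrow> complex mat" where
  "sip_mat k = mat k k (\<lambda>(i, j). if i + j + 1 = k then 1 else 0)"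

text \<open>The canonical form of the pair \<open>(B, H)\<close>.  The lists \<open>ps\<close> and \<open>ns\<close> contain the positive
  and the negative eigenvalues, \<open>es\<close> the signs of the blocks \<open>J\<^sub>1(0)\<close>, and \<open>t\<close> is the number of
  blocks \<open>J\<^sub>2(0)\<close>.  The conjunct \<^const>\<open>similar_mat_wit\<close> says that \<open>S\<close> is invertible with
  inverse \<open>T\<close> and that \<open>T * B * S\<close> is the Jordan matrix.\<close>

definition canonical_form ::
  "complex mat \<Rightarrow> complex mat \<Rightarrow> complex mat \<Rightarrow> real list \<Rightarrow> real list \<Rightarrow> complex list \<Rightarrow> nat \<Rightarrow> bool"
where
  "canonical_form H B S ps ns es t \<longleftrightarrow>
     (\<forall>l \<in> set ps. l > 0) \<and> (\<forall>l \<in> set ns. l < 0) \<and> set es \<subseteq> {1, -1} \<and>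
     (\<exists>T. similar_mat_wit
        (jordan_matrix
          (map (\<lambda>l. (1, complex_of_real l)) ps @ map (\<lambda>l. (1, complex_of_real l)) ns @
           map (\<lambda>e. (1, 0)) es @ replicate t (2, 0)))
        B T S) \<and>
     mat_adjoint S * H * S =
       diag_block_mat
         (map (\<lambda>l. sip_mat 1) ps @ map (\<lambda>l. - sip_mat 1) ns @
          map (\<lambda>e. e \<cdot>\<^sub>m sip_mat 1) es @ replicate t (sip_mat 2))"

text \<open>The canonical form of an \<open>H\<close>-nonnegative matrix exists and is unique up to simultaneous
  permutation of blocks, so the following two numbers do not depend on the form chosen.\<close>

definition s_plus :: "complex mat \<Rightarrow> complex mat \<Rightarrow> nat" where
  "s_plus H B =
     (THE p. \<exists>S ps ns es t. canonical_form H B S ps ns es t \<and> p = count_list es 1)"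

definition t_blocks :: "complex mat \<Rightarrow> complex mat \<Rightarrow> nat" where
  "t_blocks H B = (THE t. \<exists>S ps ns es. canonical_form H B S ps ns es t)"

end

theory Submission
  imports Defs
begin

text \<open>
  Write \<open>[x, y]\<close> for the form \<open>(H x, y)\<close>.  Since \<open>[B x, x] \<ge> 0\<close>, the matrix \<open>B\<close> is selfadjoint for this
  form, and \<open>[B x, x] = 0\<close> forces \<open>B x = 0\<close>; the latter is the degenerate case of the Cauchy--Schwarz
  inequality and is used throughout.

  \<^bold>\<open>Canonical bases.\<close>  A basis that brings \<open>(B, H)\<close> into canonical form is described by an
  involution \<open>\<pi>\<close> of its indices: \<open>s i\<close> pairs with \<open>s (\<pi> i)\<close> only, and \<open>B\<close> maps \<open>s i\<close> to a multiple of
  \<open>s (\<pi> i)\<close>.  Fixed points of \<open>\<pi>\<close> are blocks of size one, and a swapped pair is a chain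
  \<open>f \<mapsto> g \<mapsto> 0\<close> with \<open>[g, f] = 1\<close>, that is, a block of size two.  Such a basis is built by splitting off
  one block after the other: as long as the orthogonal complement of the vectors found is not
  trivial, it contains a non-neutral eigenvector or a chain (\<open>canonical_system_extend\<close>).

  \<^bold>\<open>The two numbers.\<close>  In every canonical basis, \<open>s\<^sub>+\<close> is the largest dimension of a subspace of the
  kernel of \<open>B\<close> on which the form is positive definite, and \<open>t\<close> is the largest dimension of a
  subspace of the kernel of \<open>B\<^sup>2\<close> that meets the kernel of \<open>B\<close> trivially.  Hence they do not depend
  on the basis.

  \<^bold>\<open>Necessity.\<close>  Let \<open>A\<close> be a selfadjoint square root, and let \<open>x\<close> be a nonzero combination of the
  top vectors \<open>f\<close> of the chains.  Then \<open>[B (A x), A x] = [B\<^sup>2 x, x] = 0\<close>, so \<open>A x\<close> is in the kernel of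
  \<open>B\<close>, and \<open>[A x, A x] = [B x, x] > 0\<close>.  So \<open>A\<close> maps the span of the \<open>t\<close> top vectors injectively onto a
  positive definite subspace of the kernel, and \<open>t \<le> s\<^sub>+\<close> (\<open>square_root_imp_card_le\<close>).  If
  \<open>B v = l v\<close> with \<open>v \<noteq> 0\<close> and \<open>l \<noteq> 0\<close>, then \<open>l\<close> and \<open>[v, v]\<close> are real, nonzero and of equal sign.  This also
  holds for the eigenvector \<open>A v\<close>, for which \<open>[A v, A v] = [B v, v] \<ge> 0\<close>; so \<open>l > 0\<close>.

  \<^bold>\<open>Sufficiency.\<close>  If \<open>t \<le> s\<^sub>+\<close>, every chain \<open>f \<mapsto> g \<mapsto> 0\<close> of \<open>B\<close> can be given its own vector \<open>h\<close> from the
  kernel with \<open>[h, h] = 1\<close>, and \<open>A\<close> is defined by \<open>f \<mapsto> h \<mapsto> g \<mapsto> 0\<close> on these vectors and by square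
  roots of the eigenvalues on the others (\<open>square_root_exists\<close>).
\<close>

section \<open>Linear algebra\<close>

text \<open>
  All dimension counts below are instances of this fact; index sets keep it independent of a
  concrete representation of vectors.
\<close>

lemma homogeneous_system_nontrivial_solution:
  fixes y :: "'i \<Rightarrow> 'j \<Rightarrow> 'a :: field"
  assumes "finite I" and "finite J" and "card I < card J"
  shows "\<exists>c. (\<exists>j\<in>J. c j \<noteq> 0) \<and> (\<forall>i\<in>I. (\<Sum>j\<in>J. c j * y i j) = 0)"
proof -
  define N where "N = card J"
  obtain e where e: "bij_betw e {..<N} J"
    using ex_bij_betw_nat_finite[OF assms(2)] by (auto simp: N_def lessThan_atLeast0)
  obtain f where f: "bij_betw f {..<card I} I"
    using ex_bij_betw_nat_finite[OF assms(1)] by (auto simp: lessThan_atLeast0)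
  \<comment> \<open>The system is padded with zero equations to a square one, and there is at least one of them.\<close>
  define Z where "Z = mat\<^sub>r N N (\<lambda>r. if r = card I then 0\<^sub>v N
    else vec N (\<lambda>q. if r < card I then y (f r) (e q) else 0))"
  have Z: "Z \<in> carrier_mat N N" by (simp add: Z_def)
  have "det Z = 0" unfolding Z_def
    by (rule det_row_0) (use assms(3) in \<open>auto simp: N_def\<close>)
  then obtain v where v: "v \<in> carrier_vec N" "v \<noteq> 0\<^sub>v N" "Z *\<^sub>v v = 0\<^sub>v N"
    using det_0_iff_vec_prod_zero[OF Z] by auto
  define c where "c = (\<lambda>j. v $ (inv_into {..<N} e j))"
  have ce: "c (e q) = v $ q" if "q < N" for q
    using that e by (simp add: c_def bij_betw_def inv_into_f_f)
  have "\<exists>q<N. v $ q \<noteq> 0"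
    using v(1,2) by (metis carrier_vecD eq_vecI index_zero_vec(1) zero_carrier_vec)
  then have 1: "\<exists>j\<in>J. c j \<noteq> 0"
    using ce e by (metis bij_betwE lessThan_iff)
  have 2: "(\<Sum>j\<in>J. c j * y i j) = 0" if "i \<in> I" for i
  proof -
    have "i \<in> f ` {..<card I}" using bij_betw_imp_surj_on[OF f] that by simp
    then obtain r where r: "r < card I" "i = f r" by blast
    then have rN: "r < N" using assms(3) by (simp add: N_def)
    have "0 = (Z *\<^sub>v v) $ r" using v(3) rN by simp
    also have "\<dots> = (\<Sum>q<N. y i (e q) * v $ q)"
      using rN r v(1) by (auto simp: Z_def scalar_prod_def lessThan_atLeast0 intro!: sum.cong)
    also have "\<dots> = (\<Sum>q<N. c (e q) * y i (e q))"
      by (rule sum.cong) (auto simp: ce)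
    also have "\<dots> = (\<Sum>j\<in>J. c j * y i j)"
      by (rule sum.reindex_bij_betw[OF e])
    finally show ?thesis by simp
  qed
  show ?thesis using 1 2 by auto
qed

lemma index_mat_adjoint:
  "i < dim_col A \<Longrightarrow> j < dim_row A \<Longrightarrow> mat_adjoint A $$ (i, j) = cnj (A $$ (j, i))"
  by (simp add: mat_adjoint_def mat_of_rows_index)

lemma mat_adjoint_carrier: "A \<in> carrier_mat m k \<Longrightarrow> mat_adjoint A \<in> carrier_mat k m"
  by (auto simp: mat_adjoint_def)

lemma mat_adjoint_cscalar_prod:
  fixes A :: "complex mat"
  assumes A: "A \<in> carrier_mat m k" and v: "v \<in> carrier_vec m" and w: "w \<in> carrier_vec k"
  shows "(mat_adjoint A *\<^sub>v v) \<bullet>c w = v \<bullet>c (A *\<^sub>v w)"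
proof -
  have "(mat_adjoint A *\<^sub>v v) \<bullet>c w = (\<Sum>i<k. (\<Sum>j<m. cnj (A $$ (j,i)) * v $ j) * cnj (w $ i))"
    using A v w mat_adjoint_carrier[OF A]
    by (auto simp: scalar_prod_def lessThan_atLeast0 index_mat_adjoint intro!: sum.cong)
  also have "\<dots> = (\<Sum>j<m. \<Sum>i<k. v $ j * (cnj (A $$ (j,i)) * cnj (w $ i)))"
    unfolding sum_distrib_right by (subst sum.swap) (simp add: mult_ac)
  also have "\<dots> = v \<bullet>c (A *\<^sub>v w)"
    using A v w by (auto simp: scalar_prod_def lessThan_atLeast0 sum_distrib_left intro!: sum.cong)
  finally show ?thesis .
qed

lemma eq_if_minus_eq_0_vec:
  fixes x y :: "'a :: group_add vec"
  assumes x: "x \<in> carrier_vec n" and y: "y \<in> carrier_vec n" and d: "x - y = 0\<^sub>v n"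
  shows "x = y"
proof (rule eq_vecI)
  fix i assume "i < dim_vec y"
  then have i: "i < n" using carrier_vecD[OF y] by simp
  then have "x $ i - y $ i = (x - y) $ i" using carrier_vecD[OF y] by simp
  then show "x $ i = y $ i" using d i by simp
qed (use carrier_vecD[OF x] carrier_vecD[OF y] in simp)

lemma mult_mat_zero_vec: "A \<in> carrier_mat m k \<Longrightarrow> A *\<^sub>v 0\<^sub>v k = 0\<^sub>v m"
  by (auto intro!: eq_vecI)

lemma mat_eqI_mult_vec:
  fixes A B :: "'a :: comm_semiring_1 mat"
  assumes "A \<in> carrier_mat m k" "B \<in> carrier_mat m k"
    and "\<And>v. v \<in> carrier_vec k \<Longrightarrow> A *\<^sub>v v = B *\<^sub>v v"
  shows "A = B"
proof (rule eq_matI)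
  fix i j assume ij: "i < dim_row B" "j < dim_col B"
  have "(A *\<^sub>v unit_vec k j) $ i = (B *\<^sub>v unit_vec k j) $ i"
    using assms(3) by simp
  then show "A $$ (i, j) = B $$ (i, j)" using assms(1,2) ij by auto
qed (use assms in auto)

lemma sum_eq_single:
  "finite I \<Longrightarrow> i \<in> I \<Longrightarrow> (\<And>j. j \<in> I \<Longrightarrow> j \<noteq> i \<Longrightarrow> f j = 0) \<Longrightarrow> sum f I = f i"
  for f :: "'b \<Rightarrow> 'c :: comm_monoid_add"
  by (subst sum.mono_neutral_right[of I "{i}"]) auto

lemma mat_mult_smult_unit_vec:
  fixes S :: "'a :: comm_semiring_1 mat"
  assumes S: "S \<in> carrier_mat m k" and p: "p < k"
  shows "S *\<^sub>v (a \<cdot>\<^sub>v unit_vec k p) = a \<cdot>\<^sub>v col S p"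
proof (rule eq_vecI)
  fix i assume "i < dim_vec (a \<cdot>\<^sub>v col S p)"
  then have i: "i < m" using S by simp
  then have "row S i \<in> carrier_vec k" using S by auto
  then show "(S *\<^sub>v (a \<cdot>\<^sub>v unit_vec k p)) $ i = (a \<cdot>\<^sub>v col S p) $ i"
    using i p S by (simp add: mult.commute)
qed (use S in auto)

lemma zero_smult_vec: "x \<in> carrier_vec n \<Longrightarrow> 0 \<cdot>\<^sub>v x = 0\<^sub>v n"
  for x :: "'a :: mult_zero vec"
  by (auto intro!: eq_vecI)

lemma triangular_reduction:
  fixes B :: "complex mat"
  assumes B: "B \<in> carrier_mat n n"
  obtains P Q U where "P \<in> carrier_mat n n" "Q \<in> carrier_mat n n" "U \<in> carrier_mat n n"
    "upper_triangular U" "P * Q = 1\<^sub>m n" "Q * B = U * Q"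
proof -
  obtain as where "char_poly B = (\<Prod>a\<leftarrow>as. [:- a, 1:])"
    using char_poly_factorized[OF B] by auto
  then obtain U where U: "upper_triangular U" "similar_mat B U"
    using schur_decomposition_exists[OF B] by blast
  then obtain P Q where "similar_mat_wit B U P Q" by (auto simp: similar_mat_def)
  note w = similar_mat_witD2[OF B this]
  have "Q * B = Q * (P * (U * Q))"
    using w by (simp add: assoc_mult_mat[of _ n n _ n _ n])
  also have "\<dots> = (Q * P) * (U * Q)"
    using w by (subst assoc_mult_mat[of _ n n _ n _ n]) auto
  also have "\<dots> = U * Q" using w by simp
  finally have "Q * B = U * Q" .
  then show thesis using that w U(1) by blast
qed

text \<open>
  On an invariant subspace \<open>V\<close> where \<open>B\<close> is not zero there is an eigenvector for a nonzero
  eigenvalue unless \<open>B\<close> is nilpotent on \<open>V\<close>, and then the last but one vector of a longest chain serves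
  as \<open>f\<close>.  The proof makes this effective without restricting \<open>B\<close> to \<open>V\<close>: starting from \<open>x\<close>, the
  factors \<open>B - a\<close>, for \<open>a\<close> on the diagonal of a triangular form of \<open>B\<close>, are applied in turn, which
  annihilates \<open>x\<close> in the end, and the step at which the vector enters the kernel of \<open>B\<close> decides.
\<close>

lemma eigenvector_or_square_zero:
  fixes B :: "complex mat"
  assumes B: "B \<in> carrier_mat n n" and V: "V \<subseteq> carrier_vec n"
    and V_minus: "\<And>x y. x \<in> V \<Longrightarrow> y \<in> V \<Longrightarrow> x - y \<in> V"
    and V_smult: "\<And>x c. x \<in> V \<Longrightarrow> c \<cdot>\<^sub>v x \<in> V"
    and V_B: "\<And>x. x \<in> V \<Longrightarrow> B *\<^sub>v x \<in> V"
    and x: "x \<in> V" "B *\<^sub>v x \<noteq> 0\<^sub>v n"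
  shows "(\<exists>v\<in>V. \<exists>a. v \<noteq> 0\<^sub>v n \<and> a \<noteq> 0 \<and> B *\<^sub>v v = a \<cdot>\<^sub>v v) \<or>
    (\<exists>f\<in>V. B *\<^sub>v f \<noteq> 0\<^sub>v n \<and> B *\<^sub>v (B *\<^sub>v f) = 0\<^sub>v n)"
proof -
  obtain P Q U where P: "P \<in> carrier_mat n n" and Q: "Q \<in> carrier_mat n n"
    and U: "U \<in> carrier_mat n n" "upper_triangular U" and PQ: "P * Q = 1\<^sub>m n"
    and QB: "Q * B = U * Q"
    using triangular_reduction[OF B] by blast
  have main: "(\<exists>v\<in>V. \<exists>a. v \<noteq> 0\<^sub>v n \<and> a \<noteq> 0 \<and> B *\<^sub>v v = a \<cdot>\<^sub>v v) \<or>
    (\<exists>f\<in>V. B *\<^sub>v f \<noteq> 0\<^sub>v n \<and> B *\<^sub>v (B *\<^sub>v f) = 0\<^sub>v n)"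
    if "k \<le> n" "x \<in> V" "B *\<^sub>v x \<noteq> 0\<^sub>v n" "\<And>i. k \<le> i \<Longrightarrow> i < n \<Longrightarrow> (Q *\<^sub>v x) $ i = 0" for k x
    using that
  proof (induction k arbitrary: x)
    case 0
    have xc: "x \<in> carrier_vec n" using V 0 by auto
    have "Q *\<^sub>v x = 0\<^sub>v n"
      using 0 Q by (intro eq_vecI) auto
    then have "P *\<^sub>v (Q *\<^sub>v x) = 0\<^sub>v n" using mult_mat_zero_vec[OF P] by simp
    then have "x = 0\<^sub>v n"
      using assoc_mult_mat_vec[OF P Q xc] PQ xc by simp
    then show ?case using 0 mult_mat_zero_vec[OF B] by simp
  next
    case (Suc k)
    have xc: "x \<in> carrier_vec n" using V Suc by auto
    define a where "a = U $$ (k, k)"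
    define w where "w = B *\<^sub>v x - a \<cdot>\<^sub>v x"
    have w: "w \<in> V" unfolding w_def using Suc by (intro V_minus V_B V_smult)
    have wc: "w \<in> carrier_vec n" using w V by auto
    \<comment> \<open>Subtracting the \<open>k\<close>-th diagonal entry removes the last coordinate.\<close>
    have "(Q *\<^sub>v w) $ i = 0" if i: "k \<le> i" "i < n" for i
    proof -
      have "Q *\<^sub>v w = Q *\<^sub>v (B *\<^sub>v x) - a \<cdot>\<^sub>v (Q *\<^sub>v x)"
        unfolding w_def using Q B xc
        by (simp add: mult_minus_distrib_mat_vec[of _ n n] mult_mat_vec[of _ n n])
      also have "Q *\<^sub>v (B *\<^sub>v x) = U *\<^sub>v (Q *\<^sub>v x)"
        using QB assoc_mult_mat_vec[OF Q B xc] assoc_mult_mat_vec[OF U(1) Q xc] by simp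
      finally have "(Q *\<^sub>v w) $ i = (U *\<^sub>v (Q *\<^sub>v x)) $ i - a * (Q *\<^sub>v x) $ i"
        using i Q U xc by (simp del: index_mult_mat_vec)
      also have "(U *\<^sub>v (Q *\<^sub>v x)) $ i = (\<Sum>j<n. U $$ (i, j) * (Q *\<^sub>v x) $ j)"
        using i Q U xc by (subst index_mult_mat_vec) (auto simp: scalar_prod_def lessThan_atLeast0)
      also have "\<dots> = (\<Sum>j\<in>{i}. U $$ (i, j) * (Q *\<^sub>v x) $ j)"
      proof (rule sum.mono_neutral_right)
        show "\<forall>j\<in>{..<n} - {i}. U $$ (i, j) * (Q *\<^sub>v x) $ j = 0"
        proof
          fix j assume j: "j \<in> {..<n} - {i}"
          show "U $$ (i, j) * (Q *\<^sub>v x) $ j = 0"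
          proof (cases "j < i")
            case True
            then show ?thesis using U i by (simp add: upper_triangular_def)
          next
            case False
            then have "(Q *\<^sub>v x) $ j = 0" using Suc.prems(4)[of j] j i by auto
            then show ?thesis by simp
          qed
        qed
      qed (use i in auto)
      finally show ?thesis
        using i Suc.prems(4)[of i] by (cases "i = k") (auto simp: a_def simp del: index_mult_mat_vec)
    qed
    note IH = Suc.IH[of w, OF _ w _ this]
    have Bx: "B *\<^sub>v x = a \<cdot>\<^sub>v x + w"
      unfolding w_def using B xc by (intro eq_vecI) auto
    show ?case
    proof (cases "B *\<^sub>v w = 0\<^sub>v n")
      case False
      then show ?thesis using IH Suc.prems(1) by simp
    next
      case True
      have Bxc: "B *\<^sub>v x \<in> carrier_vec n" using B xc by simp
      \<comment> \<open>As \<open>B (B - a) x = 0\<close>, either \<open>B x\<close> is an eigenvector for \<open>a \<noteq> 0\<close>, or \<open>a = 0\<close> and \<open>x\<close> is a top of a chain.\<close>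
      have BBx: "B *\<^sub>v (B *\<^sub>v x) = a \<cdot>\<^sub>v (B *\<^sub>v x)"
      proof -
        have "B *\<^sub>v (B *\<^sub>v x) = B *\<^sub>v (a \<cdot>\<^sub>v x + w)" using Bx by simp
        also have "\<dots> = a \<cdot>\<^sub>v (B *\<^sub>v x) + 0\<^sub>v n"
          using B xc wc True
          by (simp add: mult_add_distrib_mat_vec[of _ n n] mult_mat_vec[of _ n n])
        finally show ?thesis using Bxc by simp
      qed
      show ?thesis
      proof (cases "a = 0")
        case True
        then have "B *\<^sub>v (B *\<^sub>v x) = 0\<^sub>v n" using BBx zero_smult_vec[OF Bxc] by simp
        then show ?thesis using Suc.prems by blast
      next
        case False
        then show ?thesis using BBx Suc.prems V_B by blast
      qed
    qed
  qed
  show ?thesis by (rule main[of n]) (use x in auto)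
qed

section \<open>Indefinite inner products\<close>

locale indefinite_form =
  fixes n :: nat and H :: "complex mat"
  assumes H: "H \<in> carrier_mat n n" and H_inv: "invertible_mat H" and H_adj: "mat_adjoint H = H"
begin

abbreviation form :: "complex vec \<Rightarrow> complex vec \<Rightarrow> complex"  (\<open>\<lblot>_,/ _\<rblot>\<close>)
  where "form x y \<equiv> indef_inner H x y"

lemma form_add_left:
  "x \<in> carrier_vec n \<Longrightarrow> y \<in> carrier_vec n \<Longrightarrow> z \<in> carrier_vec n \<Longrightarrow> \<lblot>x + y, z\<rblot> = \<lblot>x, z\<rblot> + \<lblot>y, z\<rblot>"
  using H by (simp add: indef_inner_def mult_add_distrib_mat_vec[of _ n n] add_scalar_prod_distrib[of _ n])

lemma form_minus_left:
  "x \<in> carrier_vec n \<Longrightarrow> y \<in> carrier_vec n \<Longrightarrow> z \<in> carrier_vec n \<Longrightarrow> \<lblot>x - y, z\<rblot> = \<lblot>x, z\<rblot> - \<lblot>y, z\<rblot>"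
  using H by (simp add: indef_inner_def mult_minus_distrib_mat_vec[of _ n n] minus_scalar_prod_distrib[of _ n])

lemma form_smult_left:
  "x \<in> carrier_vec n \<Longrightarrow> z \<in> carrier_vec n \<Longrightarrow> \<lblot>c \<cdot>\<^sub>v x, z\<rblot> = c * \<lblot>x, z\<rblot>"
  using H by (simp add: indef_inner_def mult_mat_vec[of _ n n])

lemma form_zero_left: "z \<in> carrier_vec n \<Longrightarrow> \<lblot>0\<^sub>v n, z\<rblot> = 0"
  using form_minus_left[of "0\<^sub>v n" "0\<^sub>v n" z] by simp

lemma form_commute:
  assumes x: "x \<in> carrier_vec n" and y: "y \<in> carrier_vec n"
  shows "\<lblot>y, x\<rblot> = cnj \<lblot>x, y\<rblot>"
proof -
  have "\<lblot>y, x\<rblot> = y \<bullet>c (H *\<^sub>v x)"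
    using mat_adjoint_cscalar_prod[OF H y x] H_adj by (simp add: indef_inner_def)
  also have "\<dots> = conjugate (H *\<^sub>v x) \<bullet> y"
    using H x y by (subst conjugate_vec_sprod_comm[of _ n]) auto
  also have "\<dots> = cnj (conjugate (conjugate (H *\<^sub>v x) \<bullet> y))" by simp
  also have "\<dots> = cnj \<lblot>x, y\<rblot>"
    using H x y by (subst conjugate_conjugate_sprod[of _ n]) (auto simp: indef_inner_def)
  finally show ?thesis .
qed

lemma form_add_right:
  "x \<in> carrier_vec n \<Longrightarrow> y \<in> carrier_vec n \<Longrightarrow> z \<in> carrier_vec n \<Longrightarrow> \<lblot>z, x + y\<rblot> = \<lblot>z, x\<rblot> + \<lblot>z, y\<rblot>"
  using form_commute[of "x + y" z] form_commute[of x z] form_commute[of y z] form_add_left[of x y z]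
  by simp

lemma form_minus_right:
  "x \<in> carrier_vec n \<Longrightarrow> y \<in> carrier_vec n \<Longrightarrow> z \<in> carrier_vec n \<Longrightarrow> \<lblot>z, x - y\<rblot> = \<lblot>z, x\<rblot> - \<lblot>z, y\<rblot>"
  using form_commute[of "x - y" z] form_commute[of x z] form_commute[of y z] form_minus_left[of x y z]
  by simp

lemma form_smult_right:
  "x \<in> carrier_vec n \<Longrightarrow> z \<in> carrier_vec n \<Longrightarrow> \<lblot>z, c \<cdot>\<^sub>v x\<rblot> = cnj c * \<lblot>z, x\<rblot>"
  using form_commute[of "c \<cdot>\<^sub>v x" z] form_commute[of x z] form_smult_left[of x z c] by simp

lemma form_zero_right: "z \<in> carrier_vec n \<Longrightarrow> \<lblot>z, 0\<^sub>v n\<rblot> = 0"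
  using form_commute[of "0\<^sub>v n" z] form_zero_left[of z] by simp

lemmas form_linear = form_add_left form_minus_left form_smult_left form_zero_left
  form_add_right form_minus_right form_smult_right form_zero_right

lemma form_self_real: "x \<in> carrier_vec n \<Longrightarrow> \<lblot>x, x\<rblot> = complex_of_real (Re \<lblot>x, x\<rblot>)"
  using form_commute[of x x] by (metis Reals_cnj_iff of_real_Re)

lemma form_nondegenerate:
  assumes x: "x \<in> carrier_vec n" and "\<And>y. y \<in> carrier_vec n \<Longrightarrow> \<lblot>x, y\<rblot> = 0"
  shows "x = 0\<^sub>v n"
proof -
  have Hx: "H *\<^sub>v x \<in> carrier_vec n" using H x by simp
  have "(H *\<^sub>v x) \<bullet>c (H *\<^sub>v x) = 0"
    using assms(2)[OF Hx] by (simp add: indef_inner_def)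
  then have "H *\<^sub>v x = 0\<^sub>v n" using Hx by simp
  obtain G where "inverts_mat H G" "inverts_mat G H"
    using H_inv unfolding invertible_mat_def by auto
  then have HG: "H * G = 1\<^sub>m n" and GH: "G * H = 1\<^sub>m (dim_row G)"
    using H by (auto simp: inverts_mat_def)
  have "dim_col G = n" using arg_cong[OF HG, of dim_col] by simp
  moreover have "dim_row G = n" using arg_cong[OF GH, of dim_col] H by simp
  ultimately have G: "G \<in> carrier_mat n n" by auto
  have "(G * H) *\<^sub>v x = 0\<^sub>v n"
    using \<open>H *\<^sub>v x = 0\<^sub>v n\<close> G H x
    by (simp add: assoc_mult_mat_vec[of _ n n] mult_mat_zero_vec)
  then show ?thesis using GH G x by simp
qed

text \<open>Linear combinations are matrix-vector products \<open>S *\<^sub>v c\<close>, with the vectors as columns of \<open>S\<close>.\<close>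

lemma form_lincomb_left:
  assumes S: "S \<in> carrier_mat n k" and c: "c \<in> carrier_vec k" and y: "y \<in> carrier_vec n"
  shows "\<lblot>S *\<^sub>v c, y\<rblot> = (\<Sum>i<k. c $ i * \<lblot>col S i, y\<rblot>)"
proof -
  have *: "\<lblot>x, y\<rblot> = (\<Sum>a<n. x $ a * cnj ((H *\<^sub>v y) $ a))" if x: "x \<in> carrier_vec n" for x
  proof -
    have "\<lblot>x, y\<rblot> = x \<bullet>c (H *\<^sub>v y)"
      using mat_adjoint_cscalar_prod[OF H x y] H_adj by (simp add: indef_inner_def)
    then show ?thesis using H x y by (auto simp: scalar_prod_def lessThan_atLeast0 intro!: sum.cong)
  qed
  have "\<lblot>S *\<^sub>v c, y\<rblot> = (\<Sum>a<n. (\<Sum>i<k. S $$ (a, i) * c $ i) * cnj ((H *\<^sub>v y) $ a))"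
    using S c by (subst *) (auto simp: scalar_prod_def lessThan_atLeast0 intro!: sum.cong)
  also have "\<dots> = (\<Sum>i<k. \<Sum>a<n. S $$ (a, i) * c $ i * cnj ((H *\<^sub>v y) $ a))"
    unfolding sum_distrib_right by (rule sum.swap)
  also have "\<dots> = (\<Sum>i<k. c $ i * \<lblot>col S i, y\<rblot>)"
  proof (rule sum.cong)
    fix i assume "i \<in> {..<k}"
    then have "\<lblot>col S i, y\<rblot> = (\<Sum>a<n. S $$ (a, i) * cnj ((H *\<^sub>v y) $ a))"
      using S by (subst *) auto
    then show "(\<Sum>a<n. S $$ (a, i) * c $ i * cnj ((H *\<^sub>v y) $ a)) = c $ i * \<lblot>col S i, y\<rblot>"
      by (simp add: sum_distrib_left mult_ac)
  qed simp
  finally show ?thesis .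
qed

lemma H_selfadjoint_iff:
  assumes A: "A \<in> carrier_mat n n"
  shows "H_selfadjoint H A \<longleftrightarrow>
    (\<forall>x\<in>carrier_vec n. \<forall>y\<in>carrier_vec n. \<lblot>A *\<^sub>v x, y\<rblot> = \<lblot>x, A *\<^sub>v y\<rblot>)"
proof -
  have A': "mat_adjoint A \<in> carrier_mat n n" using A by (rule mat_adjoint_carrier)
  have l: "\<lblot>A *\<^sub>v x, y\<rblot> = (H * A *\<^sub>v x) \<bullet>c y" if "x \<in> carrier_vec n" for x y
    using that A H by (simp add: indef_inner_def)
  have r: "\<lblot>x, A *\<^sub>v y\<rblot> = (mat_adjoint A * H *\<^sub>v x) \<bullet>c y"
    if "x \<in> carrier_vec n" "y \<in> carrier_vec n" for x y
    using mat_adjoint_cscalar_prod[OF A, of "H *\<^sub>v x" y] that A A' H by (simp add: indef_inner_def)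
  show ?thesis
  proof
    assume "H_selfadjoint H A"
    then show "\<forall>x\<in>carrier_vec n. \<forall>y\<in>carrier_vec n. \<lblot>A *\<^sub>v x, y\<rblot> = \<lblot>x, A *\<^sub>v y\<rblot>"
      using l r by (simp add: H_selfadjoint_def)
  next
    assume R: "\<forall>x\<in>carrier_vec n. \<forall>y\<in>carrier_vec n. \<lblot>A *\<^sub>v x, y\<rblot> = \<lblot>x, A *\<^sub>v y\<rblot>"
    have "H * A = mat_adjoint A * H"
    proof (rule mat_eqI_mult_vec)
      fix x :: "complex vec" assume x: "x \<in> carrier_vec n"
      let ?d = "H * A *\<^sub>v x - mat_adjoint A * H *\<^sub>v x"
      have 1: "H * A *\<^sub>v x \<in> carrier_vec n" and 2: "mat_adjoint A * H *\<^sub>v x \<in> carrier_vec n"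
        and d: "?d \<in> carrier_vec n"
        using mult_mat_vec_carrier[OF mult_carrier_mat[OF H A] x]
          mult_mat_vec_carrier[OF mult_carrier_mat[OF A' H] x] by simp_all
      have "(H * A *\<^sub>v x) \<bullet>c ?d = (mat_adjoint A * H *\<^sub>v x) \<bullet>c ?d"
        using R x d l[OF x] r[OF x d] by metis
      then have "?d \<bullet>c ?d = 0"
        using 1 2 d by (simp add: minus_scalar_prod_distrib[of _ n])
      then have d0: "?d = 0\<^sub>v n" using d by simp
      show "H * A *\<^sub>v x = mat_adjoint A * H *\<^sub>v x"
        by (rule eq_if_minus_eq_0_vec[OF 1 2 d0])
    qed (use A A' H in auto)
    then show "H_selfadjoint H A" by (simp add: H_selfadjoint_def)
  qed
qed

end

section \<open>Nonnegative operators\<close>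

locale nonnegative_operator = indefinite_form +
  fixes B :: "complex mat"
  assumes B: "B \<in> carrier_mat n n" and B_nonneg: "H_nonnegative H B"
begin

lemma Bx [simp]: "x \<in> carrier_vec n \<Longrightarrow> B *\<^sub>v x \<in> carrier_vec n"
  using B by simp

lemma form_B_nonneg: "x \<in> carrier_vec n \<Longrightarrow> \<lblot>B *\<^sub>v x, x\<rblot> \<ge> 0"
  using B_nonneg H unfolding H_nonnegative_def by auto

lemma B_linear:
  "x \<in> carrier_vec n \<Longrightarrow> y \<in> carrier_vec n \<Longrightarrow> B *\<^sub>v (x + y) = B *\<^sub>v x + B *\<^sub>v y"
  "x \<in> carrier_vec n \<Longrightarrow> y \<in> carrier_vec n \<Longrightarrow> B *\<^sub>v (x - y) = B *\<^sub>v x - B *\<^sub>v y"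
  "x \<in> carrier_vec n \<Longrightarrow> B *\<^sub>v (c \<cdot>\<^sub>v x) = c \<cdot>\<^sub>v (B *\<^sub>v x)"
  using B by (auto simp: mult_add_distrib_mat_vec[of _ n n] mult_minus_distrib_mat_vec[of _ n n]
      mult_mat_vec[of _ n n])

lemma form_B_add_smult:
  assumes "x \<in> carrier_vec n" "y \<in> carrier_vec n"
  shows "\<lblot>B *\<^sub>v (y + c \<cdot>\<^sub>v x), y + c \<cdot>\<^sub>v x\<rblot> =
    \<lblot>B *\<^sub>v y, y\<rblot> + cnj c * \<lblot>B *\<^sub>v y, x\<rblot> + c * \<lblot>B *\<^sub>v x, y\<rblot> + c * cnj c * \<lblot>B *\<^sub>v x, x\<rblot>"
  using assms by (simp add: form_linear B_linear algebra_simps)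

text \<open>
  A sesquilinear form with real values on the diagonal is Hermitian: the values at \<open>y + x\<close> and at
  \<open>y + \<i> x\<close> determine the imaginary and the real part of the difference.  Apply this to \<open>[B x, y]\<close>.
\<close>

lemma form_B_left_eq_right:
  assumes x: "x \<in> carrier_vec n" and y: "y \<in> carrier_vec n"
  shows "\<lblot>B *\<^sub>v x, y\<rblot> = \<lblot>x, B *\<^sub>v y\<rblot>"
proof -
  have Im: "Im \<lblot>B *\<^sub>v z, z\<rblot> = 0" if "z \<in> carrier_vec n" for z
    using form_B_nonneg[OF that] by (simp add: less_eq_complex_def)
  have "Im \<lblot>B *\<^sub>v (y + c \<cdot>\<^sub>v x), y + c \<cdot>\<^sub>v x\<rblot> = 0" for c
    using x y by (intro Im) auto
  from this[of 1] this[of \<i>] have "\<lblot>B *\<^sub>v x, y\<rblot> = cnj \<lblot>B *\<^sub>v y, x\<rblot>"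
    using Im[OF x] Im[OF y] x y unfolding form_B_add_smult[OF x y]
    by (simp add: complex_eq_iff)
  then show ?thesis using form_commute[of "B *\<^sub>v y" x] x y by simp
qed

text \<open>
  If \<open>[B x, y] \<noteq> 0\<close>, then \<open>[B z, z]\<close> is an affine function of the real number \<open>r\<close> along
  \<open>z = y - r \<cdot> cnj [B x, y] \<cdot> x\<close>, with negative slope, and cannot stay nonnegative.
\<close>

lemma B_eq_0_if_form_eq_0:
  assumes x: "x \<in> carrier_vec n" and 0: "\<lblot>B *\<^sub>v x, x\<rblot> = 0"
  shows "B *\<^sub>v x = 0\<^sub>v n"
proof (rule form_nondegenerate)
  fix y :: "complex vec" assume y: "y \<in> carrier_vec n"
  let ?a = "\<lblot>B *\<^sub>v x, y\<rblot>"
  have a': "\<lblot>B *\<^sub>v y, x\<rblot> = cnj ?a"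
    using form_B_left_eq_right[OF y x] form_commute[of "B *\<^sub>v x" y] x y by simp
  show "?a = 0"
  proof (rule ccontr)
    assume a: "?a \<noteq> 0"
    \<comment> \<open>Large enough for the value at \<open>z = y + c \<cdot> x\<close> to be \<open>-1\<close>.\<close>
    define r where "r = (Re \<lblot>B *\<^sub>v y, y\<rblot> + 1) / (2 * (cmod ?a)\<^sup>2)"
    define c where "c = - (of_real r * cnj ?a)"
    have "0 \<le> Re \<lblot>B *\<^sub>v (y + c \<cdot>\<^sub>v x), y + c \<cdot>\<^sub>v x\<rblot>"
      using form_B_nonneg[of "y + c \<cdot>\<^sub>v x"] x y by (simp add: less_eq_complex_def)
    also have "\<dots> = Re \<lblot>B *\<^sub>v y, y\<rblot> - 2 * r * (cmod ?a)\<^sup>2"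
      unfolding form_B_add_smult[OF x y] a' 0 cmod_power2
      by (simp add: c_def power2_eq_square algebra_simps)
    also have "\<dots> = - 1" using a by (simp add: r_def field_simps)
    finally show False by simp
  qed
qed (use x in simp)

section \<open>Canonical systems\<close>

text \<open>
  The vectors \<open>s 0, \<dots>, s (k - 1)\<close> are the part of a canonical basis found so far.  Coding the blocks by
  an involution \<open>\<pi>\<close> makes both the Gram matrix and the matrix of \<open>B\<close> weighted permutation matrices of
  the same \<open>\<pi>\<close>, with weights \<open>\<sigma>\<close> and \<open>\<delta>\<close>, and leaves the order of the blocks open.  At a fixed point,
  \<open>\<sigma> i\<close> is the sign and \<open>\<delta> i\<close> the eigenvalue of a block of size one.  In a swapped pair the weight \<open>\<delta>\<close> is
  \<open>1\<close> at the top of the chain and \<open>0\<close> at its bottom, which is an eigenvector.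
\<close>

definition canonical_system ::
  "nat \<Rightarrow> (nat \<Rightarrow> complex vec) \<Rightarrow> (nat \<Rightarrow> nat) \<Rightarrow> (nat \<Rightarrow> real) \<Rightarrow> (nat \<Rightarrow> real) \<Rightarrow> bool"
where
  "canonical_system k s \<pi> \<sigma> \<delta> \<longleftrightarrow>
     (\<forall>i<k. s i \<in> carrier_vec n \<and> \<pi> i < k \<and> \<pi> (\<pi> i) = i \<and> \<sigma> (\<pi> i) = \<sigma> i \<and>
        (if \<pi> i = i then \<sigma> i \<in> {1, -1} \<and> 0 \<le> \<sigma> i * \<delta> i
         else \<sigma> i = 1 \<and> (\<delta> i = 0 \<and> \<delta> (\<pi> i) = 1 \<or> \<delta> i = 1 \<and> \<delta> (\<pi> i) = 0)) \<and>
        B *\<^sub>v s i = complex_of_real (\<delta> i) \<cdot>\<^sub>v s (\<pi> i)) \<and>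
     (\<forall>i<k. \<forall>j<k. \<lblot>s i, s j\<rblot> = (if i = \<pi> j then complex_of_real (\<sigma> j) else 0))"

lemma canonical_systemD:
  assumes "canonical_system k s \<pi> \<sigma> \<delta>" and "i < k"
  shows "s i \<in> carrier_vec n" "\<pi> i < k" "\<pi> (\<pi> i) = i" "\<sigma> (\<pi> i) = \<sigma> i"
    "\<pi> i = i \<Longrightarrow> 0 \<le> \<sigma> i * \<delta> i"
    "\<pi> i \<noteq> i \<Longrightarrow> \<sigma> i = 1"
    "\<pi> i \<noteq> i \<Longrightarrow> \<delta> i = 0 \<and> \<delta> (\<pi> i) = 1 \<or> \<delta> i = 1 \<and> \<delta> (\<pi> i) = 0"
    "\<sigma> i = 1 \<or> \<sigma> i = -1" "\<sigma> i * \<sigma> i = 1"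
    "B *\<^sub>v s i = complex_of_real (\<delta> i) \<cdot>\<^sub>v s (\<pi> i)"
    "j < k \<Longrightarrow> \<lblot>s i, s j\<rblot> = (if i = \<pi> j then complex_of_real (\<sigma> j) else 0)"
proof -
  have *: "if \<pi> i = i then \<sigma> i \<in> {1, -1} \<and> 0 \<le> \<sigma> i * \<delta> i
     else \<sigma> i = 1 \<and> (\<delta> i = 0 \<and> \<delta> (\<pi> i) = 1 \<or> \<delta> i = 1 \<and> \<delta> (\<pi> i) = 0)"
    using assms unfolding canonical_system_def by blast
  show "\<pi> i = i \<Longrightarrow> 0 \<le> \<sigma> i * \<delta> i" "\<pi> i \<noteq> i \<Longrightarrow> \<sigma> i = 1"
    "\<pi> i \<noteq> i \<Longrightarrow> \<delta> i = 0 \<and> \<delta> (\<pi> i) = 1 \<or> \<delta> i = 1 \<and> \<delta> (\<pi> i) = 0"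
    using * by presburger+
  show "\<sigma> i = 1 \<or> \<sigma> i = -1" "\<sigma> i * \<sigma> i = 1"
    using * by (cases "\<pi> i = i"; auto)+
  show "j < k \<Longrightarrow> \<lblot>s i, s j\<rblot> = (if i = \<pi> j then complex_of_real (\<sigma> j) else 0)"
    using assms unfolding canonical_system_def by blast
qed (use assms in \<open>simp_all add: canonical_system_def\<close>)

lemma canonical_systemI:
  assumes "\<And>i. i < k \<Longrightarrow> s i \<in> carrier_vec n" "\<And>i. i < k \<Longrightarrow> \<pi> i < k" "\<And>i. i < k \<Longrightarrow> \<pi> (\<pi> i) = i"
    "\<And>i. i < k \<Longrightarrow> \<sigma> (\<pi> i) = \<sigma> i"
    "\<And>i. i < k \<Longrightarrow> \<pi> i = i \<Longrightarrow> \<sigma> i \<in> {1, -1} \<and> 0 \<le> \<sigma> i * \<delta> i"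
    "\<And>i. i < k \<Longrightarrow> \<pi> i \<noteq> i \<Longrightarrow> \<sigma> i = 1 \<and> (\<delta> i = 0 \<and> \<delta> (\<pi> i) = 1 \<or> \<delta> i = 1 \<and> \<delta> (\<pi> i) = 0)"
    "\<And>i. i < k \<Longrightarrow> B *\<^sub>v s i = complex_of_real (\<delta> i) \<cdot>\<^sub>v s (\<pi> i)"
    "\<And>i j. i < k \<Longrightarrow> j < k \<Longrightarrow> \<lblot>s i, s j\<rblot> = (if i = \<pi> j then complex_of_real (\<sigma> j) else 0)"
  shows "canonical_system k s \<pi> \<sigma> \<delta>"
  using assms unfolding canonical_system_def by presburger

definition system_mat :: "nat \<Rightarrow> (nat \<Rightarrow> complex vec) \<Rightarrow> complex mat" where
  "system_mat k s = mat_of_cols n (map s [0..<k])"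

lemma system_mat_carrier [simp]: "system_mat k s \<in> carrier_mat n k"
  using mat_of_cols_carrier(1)[of n "map s [0..<k]"] by (simp add: system_mat_def)

lemma col_system_mat [simp]: "i < k \<Longrightarrow> s i \<in> carrier_vec n \<Longrightarrow> col (system_mat k s) i = s i"
  by (simp add: system_mat_def)

lemma form_system_lincomb:
  assumes "canonical_system k s \<pi> \<sigma> \<delta>" "c \<in> carrier_vec k" "y \<in> carrier_vec n"
  shows "\<lblot>system_mat k s *\<^sub>v c, y\<rblot> = (\<Sum>i<k. c $ i * \<lblot>s i, y\<rblot>)"
  using assms canonical_systemD(1)[OF assms(1)]
  by (subst form_lincomb_left[of _ k]) auto

text \<open>
  Up to sign, \<open>[x, s j]\<close> is the coordinate of \<open>x\<close> at \<open>\<pi> j\<close>; so coordinates can be read off from the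
  form, and independence of the system follows.
\<close>

lemma form_system_lincomb_base:
  assumes sys: "canonical_system k s \<pi> \<sigma> \<delta>" and c: "c \<in> carrier_vec k" and j: "j < k"
  shows "\<lblot>system_mat k s *\<^sub>v c, s j\<rblot> = c $ \<pi> j * complex_of_real (\<sigma> j)"
proof -
  note D = canonical_systemD[OF sys]
  have "\<lblot>system_mat k s *\<^sub>v c, s j\<rblot> = (\<Sum>i<k. c $ i * \<lblot>s i, s j\<rblot>)"
    by (rule form_system_lincomb[OF sys c D(1)[OF j]])
  also have "\<dots> = c $ \<pi> j * \<lblot>s (\<pi> j), s j\<rblot>"
    by (rule sum_eq_single) (use D(2,11) j in auto)
  finally show ?thesis using D(2,11) j by simp
qed

definition perp :: "nat \<Rightarrow> (nat \<Rightarrow> complex vec) \<Rightarrow> complex vec set" where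
  "perp k s = {x \<in> carrier_vec n. \<forall>j<k. \<lblot>x, s j\<rblot> = 0}"

text \<open>
  The Gram matrix of the system is its own inverse, so the orthogonal projection onto the span has
  this explicit form although the form is indefinite.
\<close>

lemma perp_remainder:
  assumes sys: "canonical_system k s \<pi> \<sigma> \<delta>" and y: "y \<in> carrier_vec n"
  defines "c \<equiv> vec k (\<lambda>i. complex_of_real (\<sigma> i) * \<lblot>y, s (\<pi> i)\<rblot>)"
  shows "y - system_mat k s *\<^sub>v c \<in> perp k s"
proof -
  note D = canonical_systemD[OF sys]
  have c: "c \<in> carrier_vec k" by (simp add: c_def)
  have Sc: "system_mat k s *\<^sub>v c \<in> carrier_vec n" by (rule mult_mat_vec_carrier) (use c in auto)
  have "\<lblot>y - system_mat k s *\<^sub>v c, s j\<rblot> = 0" if j: "j < k" for j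
  proof -
    have "\<lblot>system_mat k s *\<^sub>v c, s j\<rblot> = \<lblot>y, s j\<rblot> * complex_of_real (\<sigma> j * \<sigma> j)"
      using form_system_lincomb_base[OF sys c j] D(2,3,4)[OF j] by (simp add: c_def)
    then show ?thesis using D(1)[OF j] D(9)[OF j] Sc y by (simp add: form_minus_left del: of_real_mult)
  qed
  then show ?thesis using y Sc by (simp add: perp_def)
qed

lemma form_perp_lincomb:
  assumes sys: "canonical_system k s \<pi> \<sigma> \<delta>" and x: "x \<in> perp k s" and c: "c \<in> carrier_vec k"
  shows "\<lblot>x, system_mat k s *\<^sub>v c\<rblot> = 0"
proof -
  have xc: "x \<in> carrier_vec n" using x by (simp add: perp_def)
  have Sc: "system_mat k s *\<^sub>v c \<in> carrier_vec n" by (rule mult_mat_vec_carrier) (use c in auto)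
  have "\<lblot>s i, x\<rblot> = 0" if "i < k" for i
    using that x form_commute[OF xc canonical_systemD(1)[OF sys that]] by (simp add: perp_def)
  then have "\<lblot>system_mat k s *\<^sub>v c, x\<rblot> = 0" by (simp add: form_system_lincomb[OF sys c xc])
  then show ?thesis using form_commute[OF Sc xc] by simp
qed

lemma perp_closed:
  assumes sys: "canonical_system k s \<pi> \<sigma> \<delta>" and x: "x \<in> perp k s"
  shows "y \<in> perp k s \<Longrightarrow> x + y \<in> perp k s" "y \<in> perp k s \<Longrightarrow> x - y \<in> perp k s"
    "c \<cdot>\<^sub>v x \<in> perp k s" "B *\<^sub>v x \<in> perp k s"
proof -
  show "B *\<^sub>v x \<in> perp k s"
    using x canonical_systemD(1,2,10)[OF sys] by (auto simp: perp_def form_B_left_eq_right form_linear)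
qed (use x canonical_systemD(1)[OF sys] in \<open>auto simp: perp_def form_linear\<close>)

text \<open>
  The form is nondegenerate on the complement, because every vector differs from one in the
  complement by an element of the span.  A form that vanishes at \<open>[w, w]\<close> for all \<open>w\<close> in a subspace
  vanishes on the subspace by polarization.
\<close>

lemma perp_nonneutral_vector:
  assumes sys: "canonical_system k s \<pi> \<sigma> \<delta>" and x: "x \<in> perp k s" "x \<noteq> 0\<^sub>v n"
  shows "\<exists>w\<in>perp k s. \<lblot>w, w\<rblot> \<noteq> 0"
proof (rule ccontr)
  assume "\<not> (\<exists>w\<in>perp k s. \<lblot>w, w\<rblot> \<noteq> 0)"
  then have neutral: "\<lblot>w, w\<rblot> = 0" if "w \<in> perp k s" for w using that by blast
  have xc: "x \<in> carrier_vec n" using x by (simp add: perp_def)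
  have ortho: "\<lblot>x, z\<rblot> = 0" if z: "z \<in> perp k s" for z
  proof -
    have zc: "z \<in> carrier_vec n" using z by (simp add: perp_def)
    have "\<lblot>x + c \<cdot>\<^sub>v z, x + c \<cdot>\<^sub>v z\<rblot> = 0" for c
      using x z by (intro neutral perp_closed[OF sys])
    then have "c * \<lblot>z, x\<rblot> + cnj c * \<lblot>x, z\<rblot> = 0" for c
      using neutral[OF x(1)] neutral[OF z] xc zc by (simp add: form_linear)
    from this[of 1] this[of \<i>] show ?thesis by (simp add: complex_eq_iff)
  qed
  have "\<lblot>x, y\<rblot> = 0" if y: "y \<in> carrier_vec n" for y
  proof -
    define c where "c = vec k (\<lambda>i. complex_of_real (\<sigma> i) * \<lblot>y, s (\<pi> i)\<rblot>)"
    have c: "c \<in> carrier_vec k" by (simp add: c_def)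
    have Sc: "system_mat k s *\<^sub>v c \<in> carrier_vec n" by (rule mult_mat_vec_carrier) (use c in auto)
    have "\<lblot>x, y - system_mat k s *\<^sub>v c\<rblot> = 0"
      unfolding c_def by (rule ortho) (rule perp_remainder[OF sys y])
    then show ?thesis using form_perp_lincomb[OF sys x(1) c] xc y Sc by (simp add: form_minus_right)
  qed
  then show False using form_nondegenerate[OF xc] x by blast
qed

section \<open>Existence of a canonical basis\<close>

lemma normalize:
  assumes v: "v \<in> carrier_vec n" and nz: "\<lblot>v, v\<rblot> \<noteq> 0"
  obtains a \<sigma> where "\<sigma> = sgn (Re \<lblot>v, v\<rblot>)" "\<lblot>a \<cdot>\<^sub>v v, a \<cdot>\<^sub>v v\<rblot> = complex_of_real \<sigma>" "\<sigma> \<in> {1, -1}"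
proof -
  define r where "r = Re \<lblot>v, v\<rblot>"
  have r: "\<lblot>v, v\<rblot> = complex_of_real r" unfolding r_def by (rule form_self_real[OF v])
  then have r0: "r \<noteq> 0" using nz by auto
  define b where "b = 1 / sqrt \<bar>r\<bar>"
  have "\<lblot>complex_of_real b \<cdot>\<^sub>v v, complex_of_real b \<cdot>\<^sub>v v\<rblot> = complex_of_real (b * b * r)"
    using v r by (simp add: form_linear)
  also have "b * b * r = sgn r"
    using r0 by (simp add: b_def sgn_if abs_if)
  finally show thesis using that[of "sgn r" "complex_of_real b"] r0 by (auto simp: r_def sgn_if)
qed

lemma extend_by_eigenvector:
  assumes sys: "canonical_system k s \<pi> \<sigma> \<delta>" and v: "v \<in> perp k s"
    and form: "\<lblot>v, v\<rblot> = complex_of_real \<epsilon>" and eps: "\<epsilon> \<in> {1, -1}"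
    and eig: "B *\<^sub>v v = complex_of_real l \<cdot>\<^sub>v v" and l: "0 \<le> \<epsilon> * l"
  shows "canonical_system (Suc k) (s(k := v)) (\<pi>(k := k)) (\<sigma>(k := \<epsilon>)) (\<delta>(k := l))"
    (is "canonical_system _ ?s ?\<pi> ?\<sigma> ?\<delta>")
proof -
  note D = canonical_systemD[OF sys]
  have vc: "v \<in> carrier_vec n" using v by (simp add: perp_def)
  have vs: "\<lblot>v, s j\<rblot> = 0" "\<lblot>s j, v\<rblot> = 0" if "j < k" for j
    using that v form_commute[OF vc D(1)[OF that]] by (auto simp: perp_def)
  have lt: "\<pi> i \<noteq> k" "\<pi> i < Suc k" if "i < k" for i using D(2)[OF that] by auto
  show ?thesis
  proof (rule canonical_systemI; elim less_SucE)
    fix i assume i: "i < k"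
    show "?s i \<in> carrier_vec n" "?\<pi> i < Suc k" "?\<pi> (?\<pi> i) = i" "?\<sigma> (?\<pi> i) = ?\<sigma> i"
      "B *\<^sub>v ?s i = complex_of_real (?\<delta> i) \<cdot>\<^sub>v ?s (?\<pi> i)"
      "?\<pi> i = i \<Longrightarrow> ?\<sigma> i \<in> {1, -1} \<and> 0 \<le> ?\<sigma> i * ?\<delta> i"
      "?\<pi> i \<noteq> i \<Longrightarrow> ?\<sigma> i = 1 \<and> (?\<delta> i = 0 \<and> ?\<delta> (?\<pi> i) = 1 \<or> ?\<delta> i = 1 \<and> ?\<delta> (?\<pi> i) = 0)"
      using i D(1-8,10)[OF i] lt[OF i] by auto
  next
    fix i j assume "i < k" "j < k"
    then show "\<lblot>?s i, ?s j\<rblot> = (if i = ?\<pi> j then complex_of_real (?\<sigma> j) else 0)"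
      using D(11) by simp
  next
    fix i j assume "i < k" "j = k"
    then show "\<lblot>?s i, ?s j\<rblot> = (if i = ?\<pi> j then complex_of_real (?\<sigma> j) else 0)"
      using vs by simp
  next
    fix i j assume "i = k" "j < k"
    then show "\<lblot>?s i, ?s j\<rblot> = (if i = ?\<pi> j then complex_of_real (?\<sigma> j) else 0)"
      using vs lt[of j] by auto
  qed (use vc form eps eig l in auto)
qed

lemma extend_by_hyperbolic_pair:
  assumes sys: "canonical_system k s \<pi> \<sigma> \<delta>" and g: "g \<in> perp k s" and f: "f \<in> perp k s"
    and form: "\<lblot>g, g\<rblot> = 0" "\<lblot>f, f\<rblot> = 0" "\<lblot>g, f\<rblot> = 1"
    and chain: "B *\<^sub>v g = 0\<^sub>v n" "B *\<^sub>v f = g"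
  shows "canonical_system (Suc (Suc k)) (s(k := g, Suc k := f)) (\<pi>(k := Suc k, Suc k := k))
    (\<sigma>(k := 1, Suc k := 1)) (\<delta>(k := 0, Suc k := 1))"
    (is "canonical_system _ ?s ?\<pi> ?\<sigma> ?\<delta>")
proof -
  note D = canonical_systemD[OF sys]
  have c: "g \<in> carrier_vec n" "f \<in> carrier_vec n" using g f by (auto simp: perp_def)
  have ortho: "\<lblot>g, s j\<rblot> = 0" "\<lblot>s j, g\<rblot> = 0" "\<lblot>f, s j\<rblot> = 0" "\<lblot>s j, f\<rblot> = 0" if "j < k" for j
    using that g f form_commute[OF c(1) D(1)[OF that]] form_commute[OF c(2) D(1)[OF that]]
    by (auto simp: perp_def)
  have lt: "\<pi> i \<noteq> k" "\<pi> i \<noteq> Suc k" "\<pi> i < Suc (Suc k)" if "i < k" for i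
    using D(2)[OF that] that by auto
  have fg: "\<lblot>f, g\<rblot> = 1" using form_commute[OF c] form by simp
  have Bg: "B *\<^sub>v g = 0 \<cdot>\<^sub>v f" using chain zero_smult_vec[OF c(2)] by simp
  show ?thesis
  proof (rule canonical_systemI; elim less_SucE)
    fix i assume i: "i < k"
    show "?s i \<in> carrier_vec n" "?\<pi> i < Suc (Suc k)" "?\<pi> (?\<pi> i) = i" "?\<sigma> (?\<pi> i) = ?\<sigma> i"
      "B *\<^sub>v ?s i = complex_of_real (?\<delta> i) \<cdot>\<^sub>v ?s (?\<pi> i)"
      "?\<pi> i = i \<Longrightarrow> ?\<sigma> i \<in> {1, -1} \<and> 0 \<le> ?\<sigma> i * ?\<delta> i"
      "?\<pi> i \<noteq> i \<Longrightarrow> ?\<sigma> i = 1 \<and> (?\<delta> i = 0 \<and> ?\<delta> (?\<pi> i) = 1 \<or> ?\<delta> i = 1 \<and> ?\<delta> (?\<pi> i) = 0)"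
      using i D(1-8,10)[OF i] lt[OF i] by auto
  next
    fix i j assume "i < k" "j < k"
    then show "\<lblot>?s i, ?s j\<rblot> = (if i = ?\<pi> j then complex_of_real (?\<sigma> j) else 0)"
      using D(11) by simp
  next
    fix i j assume "i < k" "j = k"
    then show "\<lblot>?s i, ?s j\<rblot> = (if i = ?\<pi> j then complex_of_real (?\<sigma> j) else 0)"
      using ortho by simp
  next
    fix i j assume "i < k" "j = Suc k"
    then show "\<lblot>?s i, ?s j\<rblot> = (if i = ?\<pi> j then complex_of_real (?\<sigma> j) else 0)"
      using ortho by simp
  next
    fix i j assume "i = k" "j < k"
    then show "\<lblot>?s i, ?s j\<rblot> = (if i = ?\<pi> j then complex_of_real (?\<sigma> j) else 0)"
      using ortho lt[of j] by auto
  next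
    fix i j assume "i = Suc k" "j < k"
    then show "\<lblot>?s i, ?s j\<rblot> = (if i = ?\<pi> j then complex_of_real (?\<sigma> j) else 0)"
      using ortho lt[of j] by auto
  qed (use c form fg chain Bg in auto)
qed

text \<open>
  Here \<open>[B v, v] = a [v, v]\<close> is positive, since it is nonnegative and its vanishing would give \<open>B v = 0\<close>;
  and \<open>[v, v]\<close> is real.
\<close>

lemma eigenvector_nonzero_eigenvalue:
  assumes v: "v \<in> carrier_vec n" "v \<noteq> 0\<^sub>v n" and a: "a \<noteq> 0" and Bv: "B *\<^sub>v v = a \<cdot>\<^sub>v v"
  shows "\<lblot>v, v\<rblot> \<noteq> 0" "a = complex_of_real (Re a)" "0 < sgn (Re \<lblot>v, v\<rblot>) * Re a"
proof -
  have form: "\<lblot>B *\<^sub>v v, v\<rblot> = a * \<lblot>v, v\<rblot>" using v by (simp add: Bv form_linear)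
  have "B *\<^sub>v v \<noteq> 0\<^sub>v n"
  proof
    assume 0: "B *\<^sub>v v = 0\<^sub>v n"
    have "v = inverse a \<cdot>\<^sub>v (a \<cdot>\<^sub>v v)" using a v by (simp add: smult_smult_assoc)
    also have "\<dots> = 0\<^sub>v n" using 0 Bv by auto
    finally show False using v by simp
  qed
  then have "\<lblot>B *\<^sub>v v, v\<rblot> \<noteq> 0" using B_eq_0_if_form_eq_0 v by blast
  then show nz: "\<lblot>v, v\<rblot> \<noteq> 0" using form by auto
  define r where "r = Re \<lblot>v, v\<rblot>"
  have r: "\<lblot>v, v\<rblot> = complex_of_real r" unfolding r_def by (rule form_self_real[OF v(1)])
  have r0: "r \<noteq> 0" using r nz by auto
  have "0 \<le> a * complex_of_real r" "a * complex_of_real r \<noteq> 0"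
    using form_B_nonneg[OF v(1)] form r a r0 by auto
  then have *: "Im a = 0" "0 \<le> Re a * r" using r0 by (auto simp: less_eq_complex_def)
  then show ar: "a = complex_of_real (Re a)" by (simp add: complex_eq_iff)
  have "Re a \<noteq> 0" using ar a by (metis of_real_0)
  then have "0 < Re a * r" using * r0 by (simp add: less_le)
  then show "0 < sgn (Re \<lblot>v, v\<rblot>) * Re a"
    unfolding r_def[symmetric] by (auto simp: zero_less_mult_iff sgn_if)
qed

text \<open>
  The vector \<open>B f\<close> is neutral because \<open>[B f, B f] = [B\<^sup>2 f, f]\<close>, and \<open>[B f, f] > 0\<close> can be scaled to \<open>1\<close>.
  Positivity is what excludes blocks of size two with the other sign.
\<close>

lemma hyperbolic_pair_exists:
  assumes sys: "canonical_system k s \<pi> \<sigma> \<delta>" and f: "f \<in> perp k s"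
    and Bf: "B *\<^sub>v f \<noteq> 0\<^sub>v n" "B *\<^sub>v (B *\<^sub>v f) = 0\<^sub>v n"
  obtains g' f' where "g' \<in> perp k s" "f' \<in> perp k s" "\<lblot>g', g'\<rblot> = 0" "\<lblot>f', f'\<rblot> = 0" "\<lblot>g', f'\<rblot> = 1"
    "B *\<^sub>v g' = 0\<^sub>v n" "B *\<^sub>v f' = g'"
proof -
  have fc: "f \<in> carrier_vec n" using f by (simp add: perp_def)
  define p where "p = Re \<lblot>B *\<^sub>v f, f\<rblot>"
  have p: "\<lblot>B *\<^sub>v f, f\<rblot> = complex_of_real p" "0 < p"
  proof -
    have "0 \<le> \<lblot>B *\<^sub>v f, f\<rblot>" "\<lblot>B *\<^sub>v f, f\<rblot> \<noteq> 0"
      using form_B_nonneg[OF fc] B_eq_0_if_form_eq_0[OF fc] Bf by auto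
    then show "\<lblot>B *\<^sub>v f, f\<rblot> = complex_of_real p" "0 < p"
      by (auto simp: less_eq_complex_def p_def complex_eq_iff less_le)
  qed
  define b where "b = 1 / sqrt p"
  define h where "h = complex_of_real b \<cdot>\<^sub>v f"
  define g where "g = B *\<^sub>v h"
  have h: "h \<in> perp k s" unfolding h_def by (rule perp_closed[OF sys f])
  then have g: "g \<in> perp k s" unfolding g_def by (rule perp_closed[OF sys])
  have hc: "h \<in> carrier_vec n" and gc: "g \<in> carrier_vec n" using h g by (auto simp: perp_def)
  have gh: "\<lblot>g, h\<rblot> = 1"
  proof -
    have "\<lblot>g, h\<rblot> = complex_of_real (b * b * p)"
      using fc p by (simp add: g_def h_def B_linear form_linear)
    moreover have "b * b * p = 1" using p(2) by (simp add: b_def)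
    ultimately show ?thesis by simp
  qed
  have hg: "\<lblot>h, g\<rblot> = 1" using form_commute[OF gc hc] gh by simp
  have Bg: "B *\<^sub>v g = 0\<^sub>v n"
    using Bf fc by (auto simp: g_def h_def B_linear)
  have gg: "\<lblot>g, g\<rblot> = 0"
    using form_B_left_eq_right[OF hc gc] Bg hc by (simp add: g_def form_linear)
  \<comment> \<open>A multiple of \<open>g\<close> is subtracted to make the second vector neutral.\<close>
  define c where "c = complex_of_real (Re \<lblot>h, h\<rblot> / 2)"
  define f' where "f' = h - c \<cdot>\<^sub>v g"
  have f': "f' \<in> perp k s"
    unfolding f'_def by (intro perp_closed[OF sys h] perp_closed[OF sys g])
  have hh: "\<lblot>h, h\<rblot> = 2 * c"
    using form_self_real[OF hc] by (simp add: c_def)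
  have "cnj c = c" by (simp add: c_def)
  then have "\<lblot>f', f'\<rblot> = 0" "\<lblot>g, f'\<rblot> = 1" "B *\<^sub>v f' = g"
    using hc gc gh hg gg hh Bg by (auto simp: f'_def form_linear B_linear g_def[symmetric] intro!: eq_vecI)
  then show thesis using that[OF g f' gg] Bg by blast
qed

text \<open>
  If \<open>B\<close> vanishes on the complement, any non-neutral vector in it can be added; otherwise \<open>B\<close> has an
  eigenvector or a chain there.
\<close>

lemma canonical_system_extend:
  assumes sys: "canonical_system k s \<pi> \<sigma> \<delta>" and x: "x \<in> perp k s" "x \<noteq> 0\<^sub>v n"
  shows "\<exists>k'>k. \<exists>s \<pi> \<sigma> \<delta>. canonical_system k' s \<pi> \<sigma> \<delta>"
proof -
  have V: "perp k s \<subseteq> carrier_vec n" by (auto simp: perp_def)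
  consider "\<forall>x\<in>perp k s. B *\<^sub>v x = 0\<^sub>v n"
    | v a where "v \<in> perp k s" "v \<noteq> 0\<^sub>v n" "a \<noteq> 0" "B *\<^sub>v v = a \<cdot>\<^sub>v v"
    | f where "f \<in> perp k s" "B *\<^sub>v f \<noteq> 0\<^sub>v n" "B *\<^sub>v (B *\<^sub>v f) = 0\<^sub>v n"
    using eigenvector_or_square_zero[OF B V perp_closed(2)[OF sys] perp_closed(3)[OF sys] perp_closed(4)[OF sys]]
    by blast
  then show ?thesis
  proof cases
    case 1
    obtain w where w: "w \<in> perp k s" "\<lblot>w, w\<rblot> \<noteq> 0"
      using perp_nonneutral_vector[OF sys x] by blast
    have wc: "w \<in> carrier_vec n" using w by (simp add: perp_def)
    obtain a \<epsilon> where a: "\<lblot>a \<cdot>\<^sub>v w, a \<cdot>\<^sub>v w\<rblot> = complex_of_real \<epsilon>" "\<epsilon> \<in> {1, -1}"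
      using normalize[OF wc w(2)] by blast
    have aw: "a \<cdot>\<^sub>v w \<in> perp k s" by (rule perp_closed[OF sys w(1)])
    then have "B *\<^sub>v (a \<cdot>\<^sub>v w) = complex_of_real 0 \<cdot>\<^sub>v (a \<cdot>\<^sub>v w)"
      using 1 wc by (simp add: zero_smult_vec[of _ n])
    from extend_by_eigenvector[OF sys aw a this] show ?thesis by (intro exI[of _ "Suc k"]) auto
  next
    case (2 v a)
    have vc: "v \<in> carrier_vec n" using 2 by (simp add: perp_def)
    note e = eigenvector_nonzero_eigenvalue[OF vc 2(2,3,4)]
    obtain b \<epsilon> where b: "\<epsilon> = sgn (Re \<lblot>v, v\<rblot>)" "\<lblot>b \<cdot>\<^sub>v v, b \<cdot>\<^sub>v v\<rblot> = complex_of_real \<epsilon>" "\<epsilon> \<in> {1, -1}"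
      using normalize[OF vc e(1)] by blast
    have bv: "b \<cdot>\<^sub>v v \<in> perp k s" by (rule perp_closed[OF sys 2(1)])
    have "B *\<^sub>v (b \<cdot>\<^sub>v v) = complex_of_real (Re a) \<cdot>\<^sub>v (b \<cdot>\<^sub>v v)"
      using 2(4) vc e(2) by (auto simp: B_linear smult_smult_assoc mult.commute)
    from extend_by_eigenvector[OF sys bv b(2,3) this] e(3) b(1)
    show ?thesis by (intro exI[of _ "Suc k"]) auto
  next
    case (3 f)
    from hyperbolic_pair_exists[OF sys 3] obtain g' f' where "g' \<in> perp k s" "f' \<in> perp k s"
      "\<lblot>g', g'\<rblot> = 0" "\<lblot>f', f'\<rblot> = 0" "\<lblot>g', f'\<rblot> = 1" "B *\<^sub>v g' = 0\<^sub>v n" "B *\<^sub>v f' = g'" by blast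
    from extend_by_hyperbolic_pair[OF sys this] show ?thesis
      by (intro exI[of _ "Suc (Suc k)"]) auto
  qed
qed

lemma canonical_system_le_dim:
  assumes sys: "canonical_system k s \<pi> \<sigma> \<delta>"
  shows "k \<le> n"
proof (rule ccontr)
  note D = canonical_systemD[OF sys]
  assume "\<not> k \<le> n"
  then obtain c where c: "\<exists>j\<in>{..<k}. c j \<noteq> 0" "\<forall>a\<in>{..<n}. (\<Sum>j<k. c j * s j $ a) = 0"
    using homogeneous_system_nontrivial_solution[of "{..<n}" "{..<k}" "\<lambda>a j. s j $ a"] by auto
  have "system_mat k s *\<^sub>v vec k c = 0\<^sub>v n"
    using c(2) by (intro eq_vecI)
      (auto simp: system_mat_def scalar_prod_def lessThan_atLeast0 mat_of_cols_index mult.commute)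
  then have "\<lblot>0\<^sub>v n, s (\<pi> j)\<rblot> = c j * complex_of_real (\<sigma> j)" if "j < k" for j
    using form_system_lincomb_base[OF sys, of "vec k c" "\<pi> j"] that D(2,3,4)[OF that] by simp
  then have "c j = 0" if "j < k" for j
    using that D(1)[OF D(2)[OF that]] D(8)[OF that] by (fastforce simp: form_linear)
  then show False using c(1) by auto
qed

text \<open>
  A nonzero vector in the complement of \<open>n\<close> vectors of a canonical system would allow an extension
  to more than \<open>n\<close> independent vectors.
\<close>

lemma perp_basis_eq_0:
  assumes "canonical_system n s \<pi> \<sigma> \<delta>" and "x \<in> perp n s"
  shows "x = 0\<^sub>v n"
  using canonical_system_extend[OF assms] canonical_system_le_dim by fastforce

lemma perp_nontrivial:
  assumes sys: "canonical_system k s \<pi> \<sigma> \<delta>" and k: "k < n"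
  obtains x where "x \<in> perp k s" "x \<noteq> 0\<^sub>v n"
proof -
  obtain c where c: "\<exists>a\<in>{..<n}. c a \<noteq> 0" "\<forall>j\<in>{..<k}. (\<Sum>a<n. c a * \<lblot>unit_vec n a, s j\<rblot>) = 0"
    using homogeneous_system_nontrivial_solution[of "{..<k}" "{..<n}" "\<lambda>j a. \<lblot>unit_vec n a, s j\<rblot>"] k
    by auto
  have "\<lblot>vec n c, s j\<rblot> = 0" if "j < k" for j
    using form_lincomb_left[of "1\<^sub>m n" n "vec n c" "s j"] c(2) canonical_systemD(1)[OF sys that] that
    by simp
  then have "vec n c \<in> perp k s" by (simp add: perp_def)
  moreover have "vec n c \<noteq> 0\<^sub>v n"
    using c(1) by (metis index_vec index_zero_vec(1) lessThan_iff)
  ultimately show thesis using that by blast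
qed

theorem canonical_basis_exists: "\<exists>s \<pi> \<sigma> \<delta>. canonical_system n s \<pi> \<sigma> \<delta>"
proof -
  have ex: "\<exists>s \<pi> \<sigma> \<delta>. canonical_system n s \<pi> \<sigma> \<delta>" if "canonical_system k s \<pi> \<sigma> \<delta>" for k s \<pi> \<sigma> \<delta>
    using that
  proof (induction "n - k" arbitrary: k s \<pi> \<sigma> \<delta> rule: less_induct)
    case less
    show ?case
    proof (cases "k < n")
      case True
      then obtain k' s' \<pi>' \<sigma>' \<delta>' where "k' > k" "canonical_system k' s' \<pi>' \<sigma>' \<delta>'"
        using perp_nontrivial[OF less.prems] canonical_system_extend[OF less.prems] by metis
      then show ?thesis using less.hyps[of k'] True by auto
    next
      case False
      then have "k = n" using canonical_system_le_dim[OF less.prems] by simp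
      then show ?thesis using less.prems by blast
    qed
  qed
  have "canonical_system 0 s \<pi> \<sigma> \<delta>" for s \<pi> \<sigma> \<delta> by (simp add: canonical_system_def)
  then show ?thesis by (rule ex)
qed

section \<open>The invariants of a canonical basis\<close>

lemma basis_expansion:
  assumes sys: "canonical_system n s \<pi> \<sigma> \<delta>" and x: "x \<in> carrier_vec n"
  shows "x = system_mat n s *\<^sub>v vec n (\<lambda>i. complex_of_real (\<sigma> i) * \<lblot>x, s (\<pi> i)\<rblot>)"
    (is "x = ?y")
proof -
  have y: "?y \<in> carrier_vec n" by (rule mult_mat_vec_carrier) auto
  have d: "x - ?y = 0\<^sub>v n"
    by (rule perp_basis_eq_0[OF sys]) (rule perp_remainder[OF sys x])
  show ?thesis by (rule eq_if_minus_eq_0_vec[OF x y d])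
qed

text \<open>
  The form in terms of the numbers \<open>[x, s i]\<close>, which serve as coordinates from here on: by
  \<open>form_B_base\<close> the action of \<open>B\<close> on them is a rescaling combined with \<open>\<pi>\<close>.
\<close>

lemma parseval:
  assumes sys: "canonical_system n s \<pi> \<sigma> \<delta>" and x: "x \<in> carrier_vec n" and y: "y \<in> carrier_vec n"
  shows "\<lblot>x, y\<rblot> = (\<Sum>i<n. complex_of_real (\<sigma> i) * \<lblot>x, s (\<pi> i)\<rblot> * cnj \<lblot>y, s i\<rblot>)"
proof -
  have "\<lblot>x, y\<rblot> = (\<Sum>i<n. complex_of_real (\<sigma> i) * \<lblot>x, s (\<pi> i)\<rblot> * \<lblot>s i, y\<rblot>)"
    by (subst basis_expansion[OF sys x]) (subst form_system_lincomb[OF sys _ y], auto)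
  also have "\<dots> = (\<Sum>i<n. complex_of_real (\<sigma> i) * \<lblot>x, s (\<pi> i)\<rblot> * cnj \<lblot>y, s i\<rblot>)"
    using form_commute[OF y canonical_systemD(1)[OF sys]] by auto
  finally show ?thesis .
qed

lemma form_B_base:
  assumes sys: "canonical_system k s \<pi> \<sigma> \<delta>" and x: "x \<in> carrier_vec n" and j: "j < k"
  shows "\<lblot>B *\<^sub>v x, s j\<rblot> = complex_of_real (\<delta> j) * \<lblot>x, s (\<pi> j)\<rblot>"
  using x j canonical_systemD(1,2,10)[OF sys]
  by (simp add: form_B_left_eq_right form_linear)

definition positive_kernel_indices :: "(nat \<Rightarrow> nat) \<Rightarrow> (nat \<Rightarrow> real) \<Rightarrow> (nat \<Rightarrow> real) \<Rightarrow> nat set" where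
  "positive_kernel_indices \<pi> \<sigma> \<delta> = {i. i < n \<and> \<pi> i = i \<and> \<delta> i = 0 \<and> \<sigma> i = 1}"

definition chain_top_indices :: "(nat \<Rightarrow> nat) \<Rightarrow> (nat \<Rightarrow> real) \<Rightarrow> nat set" where
  "chain_top_indices \<pi> \<delta> = {i. i < n \<and> \<pi> i \<noteq> i \<and> \<delta> i = 1}"

lemma finite_indices [simp]:
  "finite (positive_kernel_indices \<pi> \<sigma> \<delta>)" "finite (chain_top_indices \<pi> \<delta>)"
  by (auto simp: positive_kernel_indices_def chain_top_indices_def)

lemma indices_subset:
  "positive_kernel_indices \<pi> \<sigma> \<delta> \<subseteq> {..<n}" "chain_top_indices \<pi> \<delta> \<subseteq> {..<n}"
  by (auto simp: positive_kernel_indices_def chain_top_indices_def)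

text \<open>
  In coordinates, the form on the kernel of \<open>B\<close> is a sum of \<open>\<sigma> i \<bar>[x, s i]\<bar>\<^sup>2\<close> over the blocks of size one for
  the eigenvalue \<open>0\<close>, because the bottoms of chains span its radical.
\<close>

lemma kernel_form_nonpositive:
  assumes sys: "canonical_system n s \<pi> \<sigma> \<delta>" and x: "x \<in> carrier_vec n" and Bx0: "B *\<^sub>v x = 0\<^sub>v n"
    and ortho: "\<And>i. i \<in> positive_kernel_indices \<pi> \<sigma> \<delta> \<Longrightarrow> \<lblot>x, s i\<rblot> = 0"
  shows "Re \<lblot>x, x\<rblot> \<le> 0"
proof -
  note D = canonical_systemD[OF sys]
  have d0: "\<lblot>x, s (\<pi> j)\<rblot> = 0" if "j < n" "\<delta> j \<noteq> 0" for j
    using form_B_base[OF sys x that(1)] Bx0 that D(1) by (auto simp: form_linear)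
  have "Re (complex_of_real (\<sigma> i) * \<lblot>x, s (\<pi> i)\<rblot> * cnj \<lblot>x, s i\<rblot>) \<le> 0" if i: "i < n" for i
  proof -
    consider "\<lblot>x, s (\<pi> i)\<rblot> = 0 \<or> \<lblot>x, s i\<rblot> = 0" | "\<pi> i = i" "\<sigma> i = -1"
      using d0[of i] d0[of "\<pi> i"] D(2,3,7,8)[OF i] i ortho[of i]
      by (cases "\<delta> i = 0"; cases "\<pi> i = i") (auto simp: positive_kernel_indices_def)
    then show ?thesis by cases auto
  qed
  then show ?thesis unfolding parseval[OF sys x x] Re_sum by (intro sum_nonpos) auto
qed

text \<open>
  The numbers \<open>[x, s (\<pi> i)]\<close> are the coordinates of \<open>x\<close> at the tops of the chains.  Without them,
  \<open>x\<close> lies in the sum of the eigenspaces of \<open>B\<close>, where \<open>B\<^sup>2\<close> and \<open>B\<close> have the same kernel.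
\<close>

lemma square_kernel_subset_kernel:
  assumes sys: "canonical_system n s \<pi> \<sigma> \<delta>" and x: "x \<in> carrier_vec n" and BBx: "B *\<^sub>v (B *\<^sub>v x) = 0\<^sub>v n"
    and ortho: "\<And>i. i \<in> chain_top_indices \<pi> \<delta> \<Longrightarrow> \<lblot>x, s (\<pi> i)\<rblot> = 0"
  shows "B *\<^sub>v x = 0\<^sub>v n"
proof -
  note D = canonical_systemD[OF sys]
  have "\<lblot>B *\<^sub>v x, s j\<rblot> = 0" if j: "j < n" for j
  proof (cases "\<pi> j = j")
    case True
    have "complex_of_real (\<delta> j) * \<lblot>B *\<^sub>v x, s j\<rblot> = 0"
      using form_B_base[OF sys Bx[OF x] j] BBx D(1)[OF j] True by (simp add: form_linear)
    then show ?thesis using form_B_base[OF sys x j] by auto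
  next
    case False
    then show ?thesis
      using form_B_base[OF sys x j] ortho[of j] D(7)[OF j] j by (auto simp: chain_top_indices_def)
  qed
  then have "B *\<^sub>v x \<in> perp n s" using x by (simp add: perp_def)
  then show ?thesis by (rule perp_basis_eq_0[OF sys])
qed

text \<open>The nonzero vectors in the span of the \<open>s j\<close> with \<open>j \<in> J\<close>, expressed by their coordinates.\<close>

definition nonzero_lincomb ::
  "(nat \<Rightarrow> complex vec) \<Rightarrow> (nat \<Rightarrow> nat) \<Rightarrow> nat set \<Rightarrow> complex vec \<Rightarrow> bool"
where
  "nonzero_lincomb s \<pi> J x \<longleftrightarrow> x \<in> carrier_vec n \<and>
     (\<forall>j<n. j \<notin> J \<longrightarrow> \<lblot>x, s (\<pi> j)\<rblot> = 0) \<and> (\<exists>j\<in>J. \<lblot>x, s (\<pi> j)\<rblot> \<noteq> 0)"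

lemma orthogonal_lincomb_exists:
  assumes sys: "canonical_system n s \<pi> \<sigma> \<delta>" and J: "J \<subseteq> {..<n}" and I: "finite I" "card I < card J"
    and w: "\<And>i. i \<in> I \<Longrightarrow> w i \<in> carrier_vec n"
  shows "\<exists>x. nonzero_lincomb s \<pi> J x \<and> (\<forall>i\<in>I. \<lblot>x, w i\<rblot> = 0)"
proof -
  note D = canonical_systemD[OF sys]
  have fJ: "finite J" using J finite_subset by blast
  obtain c j where c: "j \<in> J" "c j \<noteq> 0" "\<And>i. i \<in> I \<Longrightarrow> (\<Sum>j\<in>J. c j * \<lblot>s j, w i\<rblot>) = 0"
    using homogeneous_system_nontrivial_solution[OF I(1) fJ I(2), of "\<lambda>i j. \<lblot>s j, w i\<rblot>"] by blast
  define d where "d = vec n (\<lambda>j. if j \<in> J then c j else 0)"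
  have d: "d \<in> carrier_vec n" by (simp add: d_def)
  define x where "x = system_mat n s *\<^sub>v d"
  have x: "x \<in> carrier_vec n" unfolding x_def by (rule mult_mat_vec_carrier) (use d in auto)
  have coord: "\<lblot>x, s (\<pi> i)\<rblot> = d $ i * complex_of_real (\<sigma> i)" if "i < n" for i
    using form_system_lincomb_base[OF sys d D(2)[OF that]] D(3,4)[OF that] by (simp add: x_def)
  have "\<lblot>x, s (\<pi> i)\<rblot> = 0" if "i < n" "i \<notin> J" for i
    using coord[OF that(1)] that by (simp add: d_def)
  moreover have "\<lblot>x, s (\<pi> j)\<rblot> \<noteq> 0"
  proof -
    have "j < n" using c(1) J by auto
    then show ?thesis using coord[of j] c D(8)[of j] by (auto simp: d_def)
  qed
  moreover have "\<lblot>x, w i\<rblot> = 0" if i: "i \<in> I" for i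
  proof -
    have "\<lblot>x, w i\<rblot> = (\<Sum>j<n. d $ j * \<lblot>s j, w i\<rblot>)"
      unfolding x_def by (rule form_system_lincomb[OF sys d w[OF i]])
    also have "\<dots> = (\<Sum>j\<in>J. d $ j * \<lblot>s j, w i\<rblot>)"
      by (rule sum.mono_neutral_right) (use J in \<open>auto simp: d_def\<close>)
    also have "\<dots> = (\<Sum>j\<in>J. c j * \<lblot>s j, w i\<rblot>)"
      by (rule sum.cong) (use J in \<open>auto simp: d_def\<close>)
    finally show ?thesis using c(3)[OF i] by simp
  qed
  ultimately show ?thesis using x c(1) unfolding nonzero_lincomb_def by blast
qed

lemma positive_kernel_lincomb:
  assumes sys: "canonical_system n s \<pi> \<sigma> \<delta>" and comb: "nonzero_lincomb s \<pi> (positive_kernel_indices \<pi> \<sigma> \<delta>) x"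
  shows "B *\<^sub>v x = 0\<^sub>v n" "0 < Re \<lblot>x, x\<rblot>"
proof -
  have x: "x \<in> carrier_vec n" using comb by (simp add: nonzero_lincomb_def)
  have supp: "\<lblot>x, s (\<pi> j)\<rblot> = 0" if "j < n" "j \<notin> positive_kernel_indices \<pi> \<sigma> \<delta>" for j
    using comb that by (simp add: nonzero_lincomb_def)
  obtain j where j: "j \<in> positive_kernel_indices \<pi> \<sigma> \<delta>" "\<lblot>x, s (\<pi> j)\<rblot> \<noteq> 0"
    using comb by (auto simp: nonzero_lincomb_def)
  have "\<lblot>B *\<^sub>v x, s j\<rblot> = 0" if "j < n" for j
    using form_B_base[OF sys x that] supp[OF that] by (auto simp: positive_kernel_indices_def)
  then have "B *\<^sub>v x \<in> perp n s" using x by (simp add: perp_def)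
  then show "B *\<^sub>v x = 0\<^sub>v n" by (rule perp_basis_eq_0[OF sys])
  let ?t = "\<lambda>i. Re (complex_of_real (\<sigma> i) * \<lblot>x, s (\<pi> i)\<rblot> * cnj \<lblot>x, s i\<rblot>)"
  have on: "?t i = (cmod \<lblot>x, s (\<pi> i)\<rblot>)\<^sup>2" if "i \<in> positive_kernel_indices \<pi> \<sigma> \<delta>" for i
    using that unfolding cmod_power2 by (simp add: positive_kernel_indices_def power2_eq_square)
  have "?t i \<ge> 0" if "i < n" for i
    using on[of i] supp[OF that] by (cases "i \<in> positive_kernel_indices \<pi> \<sigma> \<delta>") auto
  moreover have "?t j > 0" using on[OF j(1)] j(2) by simp
  ultimately show "0 < Re \<lblot>x, x\<rblot>"
    unfolding parseval[OF sys x x] Re_sum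
    by (intro sum_pos2[of _ j]) (use j(1) in \<open>auto simp: positive_kernel_indices_def\<close>)
qed

lemma chain_top_lincomb:
  assumes sys: "canonical_system n s \<pi> \<sigma> \<delta>" and comb: "nonzero_lincomb s \<pi> (chain_top_indices \<pi> \<delta>) x"
  shows "B *\<^sub>v (B *\<^sub>v x) = 0\<^sub>v n" "B *\<^sub>v x \<noteq> 0\<^sub>v n"
proof -
  have x: "x \<in> carrier_vec n" using comb by (simp add: nonzero_lincomb_def)
  have supp: "\<lblot>x, s (\<pi> j)\<rblot> = 0" if "j < n" "j \<notin> chain_top_indices \<pi> \<delta>" for j
    using comb that by (simp add: nonzero_lincomb_def)
  obtain j where j: "j \<in> chain_top_indices \<pi> \<delta>" "\<lblot>x, s (\<pi> j)\<rblot> \<noteq> 0"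
    using comb by (auto simp: nonzero_lincomb_def)
  note D = canonical_systemD[OF sys]
  have "\<lblot>B *\<^sub>v (B *\<^sub>v x), s j\<rblot> = 0" if j: "j < n" for j
  proof -
    have "\<lblot>B *\<^sub>v (B *\<^sub>v x), s j\<rblot> = complex_of_real (\<delta> j) * (complex_of_real (\<delta> (\<pi> j)) * \<lblot>x, s j\<rblot>)"
      using form_B_base[OF sys Bx[OF x] j] form_B_base[OF sys x D(2)[OF j]] D(3)[OF j] by simp
    also have "\<dots> = 0"
      using D(7)[OF j] supp[OF j] by (cases "\<pi> j = j") (auto simp: chain_top_indices_def)
    finally show ?thesis .
  qed
  then have "B *\<^sub>v (B *\<^sub>v x) \<in> perp n s" using x by (simp add: perp_def)
  then show "B *\<^sub>v (B *\<^sub>v x) = 0\<^sub>v n" by (rule perp_basis_eq_0[OF sys])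
  show "B *\<^sub>v x \<noteq> 0\<^sub>v n"
  proof
    assume "B *\<^sub>v x = 0\<^sub>v n"
    then show False
      using form_B_base[OF sys x, of j] j D(1)[of j] by (auto simp: chain_top_indices_def form_linear)
  qed
qed

text \<open>
  With more positive vectors in the first basis than in the second, some nonzero combination of the
  former would be orthogonal to all of the latter, and the form would be both positive and
  nonpositive at it.
\<close>

lemma card_positive_kernel_indices_le:
  assumes sys: "canonical_system n s \<pi> \<sigma> \<delta>" and sys': "canonical_system n s' \<pi>' \<sigma>' \<delta>'"
  shows "card (positive_kernel_indices \<pi> \<sigma> \<delta>) \<le> card (positive_kernel_indices \<pi>' \<sigma>' \<delta>')"
proof (rule ccontr)
  assume "\<not> ?thesis"
  then have lt: "card (positive_kernel_indices \<pi>' \<sigma>' \<delta>') < card (positive_kernel_indices \<pi> \<sigma> \<delta>)"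
    by simp
  obtain x where x: "nonzero_lincomb s \<pi> (positive_kernel_indices \<pi> \<sigma> \<delta>) x"
    and ortho: "\<And>i. i \<in> positive_kernel_indices \<pi>' \<sigma>' \<delta>' \<Longrightarrow> \<lblot>x, s' i\<rblot> = 0"
    using orthogonal_lincomb_exists[OF sys indices_subset(1) finite_indices(1) lt, of s']
      canonical_systemD(1)[OF sys'] by (auto simp: positive_kernel_indices_def)
  have xc: "x \<in> carrier_vec n" using x by (simp add: nonzero_lincomb_def)
  from positive_kernel_lincomb[OF sys x] kernel_form_nonpositive[OF sys' xc _ ortho]
  show False by simp
qed

text \<open>
  The same count as for the positive vectors: a combination of tops of chains in one basis without
  coordinates at the tops in the other would lie in the kernel of \<open>B\<close>.
\<close>

lemma card_chain_top_indices_le: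
  assumes sys: "canonical_system n s \<pi> \<sigma> \<delta>" and sys': "canonical_system n s' \<pi>' \<sigma>' \<delta>'"
  shows "card (chain_top_indices \<pi> \<delta>) \<le> card (chain_top_indices \<pi>' \<delta>')"
proof (rule ccontr)
  assume "\<not> ?thesis"
  then have lt: "card (chain_top_indices \<pi>' \<delta>') < card (chain_top_indices \<pi> \<delta>)"
    by simp
  obtain x where x: "nonzero_lincomb s \<pi> (chain_top_indices \<pi> \<delta>) x"
    and ortho: "\<And>i. i \<in> chain_top_indices \<pi>' \<delta>' \<Longrightarrow> \<lblot>x, s' (\<pi>' i)\<rblot> = 0"
    using orthogonal_lincomb_exists[OF sys indices_subset(2) finite_indices(2) lt, of "\<lambda>i. s' (\<pi>' i)"]
      canonical_systemD(1,2)[OF sys'] by (auto simp: chain_top_indices_def)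
  have xc: "x \<in> carrier_vec n" using x by (simp add: nonzero_lincomb_def)
  from chain_top_lincomb[OF sys x] square_kernel_subset_kernel[OF sys' xc _ ortho]
  show False by simp
qed

lemma square_rootD:
  assumes A: "A \<in> carrier_mat n n" "H_selfadjoint H A" "A * A = B" and x: "x \<in> carrier_vec n"
  shows "A *\<^sub>v x \<in> carrier_vec n" "A *\<^sub>v (A *\<^sub>v x) = B *\<^sub>v x"
    "y \<in> carrier_vec n \<Longrightarrow> \<lblot>A *\<^sub>v x, y\<rblot> = \<lblot>x, A *\<^sub>v y\<rblot>"
  using A x H_selfadjoint_iff[OF A(1)] assoc_mult_mat_vec[OF A(1) A(1) x] by auto

text \<open>
  Otherwise the image under \<open>A\<close> of some nonzero combination \<open>x\<close> of tops of chains would be orthogonal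
  to all positive vectors of the kernel; but \<open>A x\<close> is in the kernel, and \<open>[A x, A x] = [B x, x] > 0\<close>.
\<close>

lemma square_root_imp_card_le:
  assumes A: "A \<in> carrier_mat n n" "H_selfadjoint H A" "A * A = B"
    and sys: "canonical_system n s \<pi> \<sigma> \<delta>"
  shows "card (chain_top_indices \<pi> \<delta>) \<le> card (positive_kernel_indices \<pi> \<sigma> \<delta>)"
proof (rule ccontr)
  note R = square_rootD[OF A]
  assume "\<not> ?thesis"
  then have lt: "card (positive_kernel_indices \<pi> \<sigma> \<delta>) < card (chain_top_indices \<pi> \<delta>)"
    by simp
  obtain x where x: "nonzero_lincomb s \<pi> (chain_top_indices \<pi> \<delta>) x"
    and ortho: "\<And>i. i \<in> positive_kernel_indices \<pi> \<sigma> \<delta> \<Longrightarrow> \<lblot>x, A *\<^sub>v s i\<rblot> = 0"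
    using orthogonal_lincomb_exists[OF sys indices_subset(2) finite_indices(1) lt, of "\<lambda>i. A *\<^sub>v s i"]
      canonical_systemD(1)[OF sys] R(1) by (auto simp: positive_kernel_indices_def)
  note top = chain_top_lincomb[OF sys x]
  have xc: "x \<in> carrier_vec n" using x by (simp add: nonzero_lincomb_def)
  have Ax: "A *\<^sub>v x \<in> carrier_vec n" by (rule R(1)[OF xc])
  have "\<lblot>B *\<^sub>v (A *\<^sub>v x), A *\<^sub>v x\<rblot> = \<lblot>A *\<^sub>v (A *\<^sub>v (A *\<^sub>v x)), A *\<^sub>v x\<rblot>"
    using R(2)[OF Ax] by simp
  also have "\<dots> = \<lblot>A *\<^sub>v (A *\<^sub>v x), A *\<^sub>v (A *\<^sub>v x)\<rblot>"
    using R(3) R(1) xc by simp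
  also have "\<dots> = \<lblot>B *\<^sub>v (B *\<^sub>v x), x\<rblot>"
    using R(2)[OF xc] form_B_left_eq_right[OF Bx[OF xc] xc] by simp
  also have "\<dots> = 0" using top(1) xc by (simp add: form_linear)
  finally have BAx: "B *\<^sub>v (A *\<^sub>v x) = 0\<^sub>v n" by (rule B_eq_0_if_form_eq_0[OF Ax])
  have "\<lblot>A *\<^sub>v x, s i\<rblot> = 0" if "i \<in> positive_kernel_indices \<pi> \<sigma> \<delta>" for i
    using ortho[OF that] R(3)[OF xc, of "s i"] canonical_systemD(1)[OF sys] that
    by (simp add: positive_kernel_indices_def)
  then have "Re \<lblot>A *\<^sub>v x, A *\<^sub>v x\<rblot> \<le> 0" by (rule kernel_form_nonpositive[OF sys Ax BAx])
  moreover have "\<lblot>A *\<^sub>v x, A *\<^sub>v x\<rblot> = \<lblot>B *\<^sub>v x, x\<rblot>"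
    using R(3)[OF Ax xc] R(2)[OF xc] by simp
  ultimately have "\<lblot>B *\<^sub>v x, x\<rblot> = 0"
    using form_B_nonneg[OF xc] by (simp add: less_eq_complex_def complex_eq_iff)
  then show False using B_eq_0_if_form_eq_0[OF xc] top(2) by simp
qed

text \<open>
  For an eigenvalue \<open>l \<noteq> 0\<close> with eigenvector \<open>v\<close>, both \<open>v\<close> and \<open>A v\<close> are eigenvectors, so their squares
  in the form have the sign of \<open>l\<close>.  But \<open>[A v, A v] = [B v, v] \<ge> 0\<close>.
\<close>

lemma square_root_imp_spectrum_nonneg:
  assumes A: "A \<in> carrier_mat n n" "H_selfadjoint H A" "A * A = B"
  shows "spectrum B \<subseteq> complex_of_real ` {0..}"
proof
  note R = square_rootD[OF A]
  fix l assume "l \<in> spectrum B"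
  then obtain v where v: "v \<in> carrier_vec n" "v \<noteq> 0\<^sub>v n" "B *\<^sub>v v = l \<cdot>\<^sub>v v"
    using B by (auto simp: spectrum_def eigenvalue_def eigenvector_def)
  show "l \<in> complex_of_real ` {0..}"
  proof (cases "l = 0")
    case False
    note v_eig = eigenvector_nonzero_eigenvalue[OF v(1,2) False v(3)]
    let ?u = "A *\<^sub>v v"
    have u: "?u \<in> carrier_vec n" by (rule R(1)[OF v(1)])
    have uu: "\<lblot>?u, ?u\<rblot> = \<lblot>B *\<^sub>v v, v\<rblot>"
      using R(3)[OF u v(1)] R(2)[OF v(1)] by simp
    have "\<lblot>B *\<^sub>v v, v\<rblot> \<noteq> 0"
      using v False v_eig(1) by (simp add: form_linear)
    then have u0: "?u \<noteq> 0\<^sub>v n" using uu u by (metis form_zero_left)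
    have "B *\<^sub>v ?u = A *\<^sub>v (B *\<^sub>v v)" using R(2)[OF u] R(2)[OF v(1)] by simp
    also have "\<dots> = l \<cdot>\<^sub>v ?u" using v A(1) by (simp add: mult_mat_vec[of _ n n])
    finally have "0 < sgn (Re \<lblot>?u, ?u\<rblot>) * Re l"
      using eigenvector_nonzero_eigenvalue(3)[OF u u0 False] by simp
    moreover have "0 \<le> Re \<lblot>?u, ?u\<rblot>"
      using form_B_nonneg[OF v(1)] uu by (simp add: less_eq_complex_def)
    ultimately have "0 \<le> Re l" by (auto simp: zero_less_mult_iff sgn_if split: if_splits)
    then show ?thesis using v_eig(2) by (metis atLeast_iff image_eqI)
  qed force
qed

end

section \<open>The matrices of the canonical form\<close>

text \<open>
  The involution of the canonical form in its prescribed order: \<open>m\<close> blocks of size one come first, and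
  the indices from \<open>m\<close> on are swapped in consecutive pairs.
\<close>

definition pair_swap :: "nat \<Rightarrow> nat \<Rightarrow> nat" where
  "pair_swap m i = (if i < m then i else if even (i - m) then i + 1 else i - 1)"

lemma pair_swap_Suc_Suc [simp]: "pair_swap (Suc m) (Suc j) = Suc (pair_swap m j)"
  by (auto simp: pair_swap_def elim: oddE)

lemma pair_swap_Suc_0 [simp]: "pair_swap (Suc m) 0 = 0"
  by (simp add: pair_swap_def)

lemma pair_swap_add: "pair_swap m (m + r) = m + (if even r then r + 1 else r - 1)"
  by (auto simp: pair_swap_def elim: oddE)

lemma pair_swap_involution: "pair_swap m (pair_swap m i) = i"
proof (cases "i < m")
  case False
  then obtain r where "i = m + r" using le_Suc_ex not_less by blast
  then show ?thesis
    using pair_swap_add[of m "Suc r"] by (cases "even r") (auto simp: pair_swap_add elim!: oddE)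
qed (simp add: pair_swap_def)

lemma pair_swap_less: "i < m + 2 * t \<Longrightarrow> pair_swap m i < m + 2 * t"
proof (cases "i < m")
  case False
  assume i: "i < m + 2 * t"
  obtain r where r: "i = m + r" using False le_Suc_ex not_less by blast
  with i have "r + 1 < 2 * t" if "even r" using that by (auto elim!: evenE)
  then show ?thesis using i r by (auto simp: pair_swap_add)
qed (simp add: pair_swap_def)

lemma pair_swap_fixed_iff: "pair_swap m i = i \<longleftrightarrow> i < m"
  by (auto simp: pair_swap_def elim: oddE)

lemma diag_block_mat_replicate:
  "diag_block_mat (replicate t (mat 2 2 (\<lambda>(i, j). if i + j = 1 then w j else 0))) =
    mat (2 * t) (2 * t) (\<lambda>(i, j). if i = pair_swap 0 j then w (j mod 2) else (0 :: 'a :: zero))"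
proof (induction t)
  case (Suc t)
  have shift: "pair_swap 0 (Suc (Suc j)) = Suc (Suc (pair_swap 0 j))" for j
    by (auto simp: pair_swap_def elim: oddE)
  define A where "A = mat 2 2 (\<lambda>(i, j). if i + j = 1 then w j else 0)"
  let ?r = "\<lambda>t. mat (2 * t) (2 * t) (\<lambda>(i, j). if i = pair_swap 0 j then w (j mod 2) else 0)"
  have A: "dim_row A = 2" "dim_col A = 2" by (auto simp: A_def)
  have A_entry: "A $$ (0, 0) = 0" "A $$ (0, Suc 0) = w (Suc 0)" "A $$ (Suc 0, 0) = w 0"
    "A $$ (Suc 0, Suc 0) = 0" by (auto simp: A_def)
  have step: "diag_block_mat (replicate (Suc t) A) =
      four_block_mat A (0\<^sub>m 2 (2 * t)) (0\<^sub>m (2 * t) 2) (?r t)"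
    using Suc.IH[folded A_def] A by (simp add: Let_def)
  have "diag_block_mat (replicate (Suc t) A) = ?r (Suc t)"
  proof (rule eq_matI)
    fix i j assume "i < dim_row (?r (Suc t))" "j < dim_col (?r (Suc t))"
    then have ij: "i < 2 * Suc t" "j < 2 * Suc t" by auto
    have c: "k = 0 \<or> k = 1 \<or> (\<exists>k'. k = Suc (Suc k'))" for k :: nat by presburger
    have z: "pair_swap 0 0 = 1" "pair_swap 0 (Suc 0) = 0" by (auto simp: pair_swap_def)
    show "diag_block_mat (replicate (Suc t) A) $$ (i, j) = ?r (Suc t) $$ (i, j)"
      unfolding step using c[of i] c[of j] ij
      by (elim disjE exE; simp add: A A_entry shift z)
  qed (unfold step, auto simp: A)
  then show ?case by (simp only: A_def)
qed auto

lemma diag_block_mat_singletons_pairs: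
  "diag_block_mat (map (\<lambda>x. mat 1 1 (\<lambda>_. x)) ds @
      replicate t (mat 2 2 (\<lambda>(i, j). if i + j = 1 then w j else 0))) =
    mat (length ds + 2 * t) (length ds + 2 * t) (\<lambda>(i, j). if i = pair_swap (length ds) j then
      (if j < length ds then ds ! j else w ((j - length ds) mod 2)) else (0 :: 'a :: zero))"
  (is "?l ds = ?r ds")
proof (induction ds)
  case Nil
  show ?case using diag_block_mat_replicate[of t w] by (simp add: split_def cong: if_cong)
next
  case (Cons d ds)
  have step: "?l (d # ds) = four_block_mat (mat 1 1 (\<lambda>_. d)) (0\<^sub>m 1 (length ds + 2 * t))
      (0\<^sub>m (length ds + 2 * t) 1) (?r ds)"
    using Cons.IH by (simp add: Let_def)
  show ?case
  proof (rule eq_matI)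
    fix i j assume "i < dim_row (?r (d # ds))" "j < dim_col (?r (d # ds))"
    then show "?l (d # ds) $$ (i, j) = ?r (d # ds) $$ (i, j)"
      unfolding step by (cases i; cases j) auto
  qed (unfold step, auto)
qed

text \<open>The blocks of size one as pairs of an eigenvalue and a sign.\<close>

definition block_list :: "real list \<Rightarrow> real list \<Rightarrow> complex list \<Rightarrow> (real \<times> real) list" where
  "block_list ps ns es = map (\<lambda>l. (l, 1)) ps @ map (\<lambda>l. (l, -1)) ns @ map (\<lambda>e. (0, Re e)) es"

text \<open>The second vector of a block of size two is the top of its chain.\<close>

definition block_weights :: "(real \<times> real) list \<Rightarrow> nat \<Rightarrow> real" where
  "block_weights bs j = (if j < length bs then fst (bs ! j) else real ((j - length bs) mod 2))"

definition block_signs :: "(real \<times> real) list \<Rightarrow> nat \<Rightarrow> real" where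
  "block_signs bs j = (if j < length bs then snd (bs ! j) else 1)"

lemma block_signs_pair_swap: "block_signs bs (pair_swap (length bs) i) = block_signs bs i"
proof (cases "i < length bs")
  case False
  then obtain r where "i = length bs + r" using le_Suc_ex not_less by blast
  then show ?thesis by (simp add: block_signs_def pair_swap_add)
qed (simp add: pair_swap_def)

lemma jordan_matrix_explicit:
  assumes "bs = block_list ps ns es"
  shows "jordan_matrix (map (\<lambda>l. (1, complex_of_real l)) ps @ map (\<lambda>l. (1, complex_of_real l)) ns @
      map (\<lambda>e. (1, 0)) es @ replicate t (2, 0)) =
    mat (length bs + 2 * t) (length bs + 2 * t)
      (\<lambda>(i, j). if i = pair_swap (length bs) j then complex_of_real (block_weights bs j) else 0)"
proof -
  have J1: "jordan_block (Suc 0) a = mat 1 1 (\<lambda>_. a)" for a :: complex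
    by (auto simp: jordan_block_def)
  have J2: "jordan_block 2 (0 :: complex) = mat 2 2 (\<lambda>(i, j). if i + j = 1 then of_nat j else 0)"
    by (auto simp: jordan_block_def less_2_cases_iff intro!: eq_matI)
  let ?ds = "map (\<lambda>b. complex_of_real (fst b)) bs"
  have "jordan_matrix (map (\<lambda>l. (1, complex_of_real l)) ps @ map (\<lambda>l. (1, complex_of_real l)) ns @
      map (\<lambda>e. (1, 0)) es @ replicate t (2, 0)) =
    diag_block_mat (map (\<lambda>x. mat 1 1 (\<lambda>_. x)) ?ds @
      replicate t (mat 2 2 (\<lambda>(i, j). if i + j = 1 then of_nat j else 0)))"
    unfolding jordan_matrix_def assms block_list_def by (simp add: J1 J2 comp_def)
  also have "\<dots> = mat (length bs + 2 * t) (length bs + 2 * t)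
      (\<lambda>(i, j). if i = pair_swap (length bs) j then complex_of_real (block_weights bs j) else 0)"
    unfolding diag_block_mat_singletons_pairs by (rule cong_mat) (auto simp: block_weights_def)
  finally show ?thesis .
qed

lemma gram_matrix_explicit:
  assumes "bs = block_list ps ns es" and "set es \<subseteq> {1, -1}"
  shows "diag_block_mat (map (\<lambda>l. sip_mat 1) ps @ map (\<lambda>l. - sip_mat 1) ns @
      map (\<lambda>e. e \<cdot>\<^sub>m sip_mat 1) es @ replicate t (sip_mat 2)) =
    mat (length bs + 2 * t) (length bs + 2 * t)
      (\<lambda>(i, j). if i = pair_swap (length bs) j then complex_of_real (block_signs bs j) else 0)"
proof -
  have Q1: "mat (Suc 0) (Suc 0) (\<lambda>_. 1) = sip_mat (Suc 0)"
    "mat (Suc 0) (Suc 0) (\<lambda>_. -1) = - sip_mat (Suc 0)"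
    "e \<in> set es \<Longrightarrow> mat (Suc 0) (Suc 0) (\<lambda>_. complex_of_real (Re e)) = e \<cdot>\<^sub>m sip_mat (Suc 0)" for e
    using assms(2) by (auto simp: sip_mat_def intro!: eq_matI)
  have Q2: "mat 2 2 (\<lambda>(i, j). if i + j = 1 then 1 else 0) = sip_mat 2"
    by (auto simp: sip_mat_def intro!: eq_matI)
  let ?ds = "map (\<lambda>b. complex_of_real (snd b)) bs"
  have "map (\<lambda>l. sip_mat 1) ps @ map (\<lambda>l. - sip_mat 1) ns @
      map (\<lambda>e. e \<cdot>\<^sub>m sip_mat 1) es @ replicate t (sip_mat 2) =
    map (\<lambda>x. mat 1 1 (\<lambda>_. x)) ?ds @
      replicate t (mat 2 2 (\<lambda>(i, j). if i + j = 1 then 1 else 0))"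
    unfolding assms(1) block_list_def Q2 by (simp add: Q1 comp_def)
  then have "diag_block_mat (map (\<lambda>l. sip_mat 1) ps @ map (\<lambda>l. - sip_mat 1) ns @
      map (\<lambda>e. e \<cdot>\<^sub>m sip_mat 1) es @ replicate t (sip_mat 2)) =
    diag_block_mat (map (\<lambda>x. mat 1 1 (\<lambda>_. x)) ?ds @
      replicate t (mat 2 2 (\<lambda>(i, j). if i + j = 1 then 1 else 0)))"
    by (rule arg_cong)
  also have "\<dots> = mat (length bs + 2 * t) (length bs + 2 * t)
      (\<lambda>(i, j). if i = pair_swap (length bs) j then complex_of_real (block_signs bs j) else 0)"
    unfolding diag_block_mat_singletons_pairs[of _ t "\<lambda>_. 1"] by (rule cong_mat) (auto simp: block_signs_def)
  finally show ?thesis .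
qed

lemma nth_concat_pairs:
  assumes "l < length xs"
  shows "concat (map (\<lambda>x. [g x, h x]) xs) ! (2 * l) = g (xs ! l)"
    and "concat (map (\<lambda>x. [g x, h x]) xs) ! Suc (2 * l) = h (xs ! l)"
  using assms by (induction xs arbitrary: l; auto simp: nth_Cons' less_Suc_eq_0_disj)+

lemma distinct_concat_pairs:
  assumes "distinct xs" and "inj_on g (set xs)" and "g ` set xs \<inter> set xs = {}"
  shows "distinct (concat (map (\<lambda>i. [g i, i]) xs))"
  using assms by (induction xs) auto

context nonnegative_operator
begin

section \<open>Construction of a square root\<close>

lemma system_mat_inverse:
  assumes sys: "canonical_system n s \<pi> \<sigma> \<delta>"
  obtains T where "T \<in> carrier_mat n n" "system_mat n s * T = 1\<^sub>m n" "T * system_mat n s = 1\<^sub>m n"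
proof -
  define C where "C = (\<lambda>x. vec n (\<lambda>i. complex_of_real (\<sigma> i) * \<lblot>x, s (\<pi> i)\<rblot>))"
  define T where "T = mat_of_cols n (map (\<lambda>a. C (unit_vec n a)) [0..<n])"
  have T: "T \<in> carrier_mat n n"
    using mat_of_cols_carrier(1)[of n "map (\<lambda>a. C (unit_vec n a)) [0..<n]"] by (simp add: T_def)
  have "system_mat n s * T = 1\<^sub>m n"
  proof (rule mat_col_eqI)
    fix a assume "a < dim_col (1\<^sub>m n :: complex mat)"
    then have a: "a < n" by simp
    have "col (system_mat n s * T) a = system_mat n s *\<^sub>v col T a"
      using a T by (intro col_mult2[of _ n n _ n]) auto
    also have "col T a = C (unit_vec n a)" using a by (simp add: T_def C_def)
    also have "system_mat n s *\<^sub>v \<dots> = unit_vec n a"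
      unfolding C_def by (rule basis_expansion[OF sys, symmetric]) simp
    finally show "col (system_mat n s * T) a = col (1\<^sub>m n) a" using a by simp
  qed (use T carrier_matD[OF system_mat_carrier[of n s]] in auto)
  then show thesis using that[OF T] mat_mult_left_right_inverse[OF system_mat_carrier T] by blast
qed

lemma operator_with_values_on_basis:
  assumes sys: "canonical_system n s \<pi> \<sigma> \<delta>" and w: "\<And>j. j < n \<Longrightarrow> w j \<in> carrier_vec n"
  obtains A where "A \<in> carrier_mat n n" "\<And>j. j < n \<Longrightarrow> A *\<^sub>v s j = w j"
proof -
  obtain T where T: "T \<in> carrier_mat n n" "T * system_mat n s = 1\<^sub>m n"
    using system_mat_inverse[OF sys] by blast
  have A: "system_mat n w * T \<in> carrier_mat n n" using T by (intro mult_carrier_mat) auto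
  have "(system_mat n w * T) *\<^sub>v s j = w j" if j: "j < n" for j
  proof -
    have sj: "s j \<in> carrier_vec n" by (rule canonical_systemD(1)[OF sys j])
    have "T *\<^sub>v s j = col (T * system_mat n s) j"
      using T(1) j sj by (subst col_mult2[of _ n n _ n]) auto
    also have "\<dots> = unit_vec n j" using T(2) j by simp
    finally have "(system_mat n w * T) *\<^sub>v s j = system_mat n w *\<^sub>v unit_vec n j"
      using T sj by (subst assoc_mult_mat_vec[of _ n n _ n]) auto
    also have "\<dots> = col (system_mat n w * 1\<^sub>m n) j"
      using j by (subst col_mult2[of _ n n _ n]) auto
    also have "\<dots> = w j" using j w by (subst right_mult_one_mat[of _ n n]) auto
    finally show ?thesis .
  qed
  then show thesis using that[OF A] by blast
qed

lemma mat_eq_if_eq_on_basis: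
  assumes sys: "canonical_system n s \<pi> \<sigma> \<delta>" and A: "A \<in> carrier_mat n n" and C: "C \<in> carrier_mat n n"
    and eq: "\<And>j. j < n \<Longrightarrow> A *\<^sub>v s j = C *\<^sub>v s j"
  shows "A = C"
proof -
  obtain T where T: "T \<in> carrier_mat n n" "system_mat n s * T = 1\<^sub>m n"
    using system_mat_inverse[OF sys] by blast
  have S: "system_mat n s \<in> carrier_mat n n" by simp
  have "A * system_mat n s = C * system_mat n s"
  proof (rule mat_col_eqI)
    fix j assume "j < dim_col (C * system_mat n s)"
    then have j: "j < n" using S by (metis carrier_matD(2) index_mult_mat(3))
    show "col (A * system_mat n s) j = col (C * system_mat n s) j"
      using col_mult2[OF A S j] col_mult2[OF C S j] eq[OF j] canonical_systemD(1)[OF sys j] j by simp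
  qed (use A C in auto)
  then have "A * system_mat n s * T = C * system_mat n s * T" by simp
  then show ?thesis using A C S T by (simp add: assoc_mult_mat[of _ n n _ n _ n])
qed

lemma H_selfadjoint_if_on_basis:
  assumes sys: "canonical_system n s \<pi> \<sigma> \<delta>" and A: "A \<in> carrier_mat n n"
    and eq: "\<And>i j. i < n \<Longrightarrow> j < n \<Longrightarrow> \<lblot>A *\<^sub>v s j, s i\<rblot> = \<lblot>s j, A *\<^sub>v s i\<rblot>"
  shows "H_selfadjoint H A"
proof -
  have S: "system_mat n s \<in> carrier_mat n n" by simp
  have Ac: "A *\<^sub>v x \<in> carrier_vec n" if "x \<in> carrier_vec n" for x using A that by simp
  have sc: "s i \<in> carrier_vec n" if "i < n" for i by (rule canonical_systemD(1)[OF sys that])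
  have step: "\<lblot>A *\<^sub>v x, y\<rblot> = \<lblot>x, A *\<^sub>v y\<rblot>"
    if x: "x \<in> carrier_vec n" and y: "y \<in> carrier_vec n"
      and on: "\<And>i. i < n \<Longrightarrow> \<lblot>A *\<^sub>v s i, y\<rblot> = \<lblot>s i, A *\<^sub>v y\<rblot>" for x y
  proof -
    obtain c where c: "c \<in> carrier_vec n" "x = system_mat n s *\<^sub>v c"
      using basis_expansion[OF sys x] by (metis vec_carrier)
    have "\<lblot>A *\<^sub>v x, y\<rblot> = \<lblot>(A * system_mat n s) *\<^sub>v c, y\<rblot>"
      using A S c by (simp add: assoc_mult_mat_vec[of _ n n _ n])
    also have "\<dots> = (\<Sum>i<n. c $ i * \<lblot>col (A * system_mat n s) i, y\<rblot>)"
      by (rule form_lincomb_left) (use A S c y in auto)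
    also have "\<dots> = (\<Sum>i<n. c $ i * \<lblot>s i, A *\<^sub>v y\<rblot>)"
      by (rule sum.cong) (use col_mult2[OF A S] on sc in auto)
    also have "\<dots> = \<lblot>x, A *\<^sub>v y\<rblot>"
      using form_system_lincomb[OF sys c(1) Ac[OF y]] c(2) by simp
    finally show ?thesis .
  qed
  have 1: "\<lblot>A *\<^sub>v x, s i\<rblot> = \<lblot>x, A *\<^sub>v s i\<rblot>" if "x \<in> carrier_vec n" "i < n" for x i
    by (rule step[OF that(1) sc[OF that(2)]]) (use eq that in auto)
  have 2: "\<lblot>A *\<^sub>v s i, y\<rblot> = \<lblot>s i, A *\<^sub>v y\<rblot>" if "y \<in> carrier_vec n" "i < n" for y i
    using 1[OF that] form_commute[OF Ac[OF that(1)] sc[OF that(2)]]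
      form_commute[OF that(1) Ac[OF sc[OF that(2)]]] by simp
  show ?thesis
    unfolding H_selfadjoint_iff[OF A] using step 2 by blast
qed

text \<open>
  Choose an injection \<open>\<phi>\<close> from the tops of chains to the positive vectors of the kernel.  On \<open>i\<close>, \<open>\<phi> i\<close>
  and \<open>\<pi> i\<close> the square root is the nilpotent block \<open>s i \<mapsto> s (\<phi> i) \<mapsto> s (\<pi> i) \<mapsto> 0\<close>.  It is selfadjoint since
  both \<open>[A (s i), s (\<phi> i)]\<close> and \<open>[s i, A (s (\<phi> i))]\<close> are \<open>1\<close>, which is where the positive sign is needed.
\<close>

lemma square_root_exists:
  assumes sys: "canonical_system n s \<pi> \<sigma> \<delta>"
    and nonneg: "\<And>i. i < n \<Longrightarrow> 0 \<le> \<delta> i"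
    and card: "card (chain_top_indices \<pi> \<delta>) \<le> card (positive_kernel_indices \<pi> \<sigma> \<delta>)"
  shows "\<exists>A\<in>carrier_mat n n. H_selfadjoint H A \<and> A * A = B"
proof -
  note D = canonical_systemD[OF sys]
  let ?F = "chain_top_indices \<pi> \<delta>" and ?P = "positive_kernel_indices \<pi> \<sigma> \<delta>"
  obtain \<phi> where \<phi>: "\<phi> ` ?F \<subseteq> ?P" "inj_on \<phi> ?F"
    using card_le_inj[of ?F ?P] card by auto
  have FD: "i < n" "\<pi> i \<noteq> i" "\<delta> i = 1" "\<delta> (\<pi> i) = 0" "\<sigma> i = 1" if "i \<in> ?F" for i
    using that D(6,7)[of i] by (auto simp: chain_top_indices_def)
  have PD: "\<phi> i < n" "\<pi> (\<phi> i) = \<phi> i" "\<delta> (\<phi> i) = 0" "\<sigma> (\<phi> i) = 1" "\<phi> i \<notin> ?F" if "i \<in> ?F" for i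
    using that \<phi>(1) by (auto simp: positive_kernel_indices_def chain_top_indices_def)
  have \<pi>F: "\<pi> i \<notin> ?F" "\<pi> i \<notin> \<phi> ` ?F" if i: "i \<in> ?F" for i
  proof -
    show "\<pi> i \<notin> ?F" using FD(4)[OF i] by (auto simp: chain_top_indices_def)
    show "\<pi> i \<notin> \<phi> ` ?F"
    proof
      assume "\<pi> i \<in> \<phi> ` ?F"
      then have "\<pi> (\<pi> i) = \<pi> i" using PD(2) by auto
      then show False using D(3)[OF FD(1)[OF i]] FD(2)[OF i] by simp
    qed
  qed
  \<comment> \<open>The square root maps \<open>s i\<close> to \<open>\<alpha> i \<cdot> s (\<rho> i)\<close>.\<close>
  define \<rho> where "\<rho> i = (if i \<in> ?F then \<phi> i else if i \<in> \<phi> ` ?F then \<pi> (inv_into ?F \<phi> i) else i)" for i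
  define \<alpha> where "\<alpha> i = (if i \<in> ?F \<union> \<phi> ` ?F then 1 else if \<pi> i = i then sqrt (\<delta> i) else 0)" for i
  have top: "\<rho> i = \<phi> i" "\<alpha> i = 1" if "i \<in> ?F" for i using that by (auto simp: \<rho>_def \<alpha>_def)
  have mid: "\<rho> (\<phi> i) = \<pi> i" "\<alpha> (\<phi> i) = 1" if "i \<in> ?F" for i
    using that PD(5)[OF that] \<phi>(2) by (auto simp: \<rho>_def \<alpha>_def inv_into_f_f)
  have bot: "\<alpha> (\<pi> i) = 0" if "i \<in> ?F" for i
    using \<pi>F[OF that] FD[OF that] D(3)[of i] by (simp add: \<alpha>_def)
  have cases: thesis if i: "i < n" and "i \<in> ?F \<Longrightarrow> thesis" "\<And>k. k \<in> ?F \<Longrightarrow> i = \<phi> k \<Longrightarrow> thesis"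
    "\<And>k. k \<in> ?F \<Longrightarrow> i = \<pi> k \<Longrightarrow> thesis"
    "\<pi> i = i \<Longrightarrow> \<rho> i = i \<Longrightarrow> \<alpha> i = sqrt (\<delta> i) \<Longrightarrow> thesis" for i thesis
  proof -
    consider "i \<in> ?F" | k where "k \<in> ?F" "i = \<phi> k" | "i \<notin> ?F" "i \<notin> \<phi> ` ?F" "\<pi> i = i"
      | "i \<notin> ?F" "\<pi> i \<noteq> i" by blast
    then show thesis
    proof cases
      case 4
      then have "\<pi> i \<in> ?F"
        using D(2,3,7)[OF i] i by (auto simp: chain_top_indices_def)
      then show thesis using that(4)[of "\<pi> i"] D(3)[OF i] by simp
    qed (use that in \<open>auto simp: \<rho>_def \<alpha>_def\<close>)
  qed
  have \<rho>n: "\<rho> j < n" if "j < n" for j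
  proof (rule cases[OF that])
    fix k assume "k \<in> ?F" "j = \<pi> k"
    then show ?thesis using \<pi>F[of k] that by (simp add: \<rho>_def)
  qed (use that in \<open>auto simp: top mid PD FD D(2)\<close>)
  obtain A where A: "A \<in> carrier_mat n n"
    "\<And>j. j < n \<Longrightarrow> A *\<^sub>v s j = complex_of_real (\<alpha> j) \<cdot>\<^sub>v s (\<rho> j)"
    using operator_with_values_on_basis[OF sys, of "\<lambda>j. complex_of_real (\<alpha> j) \<cdot>\<^sub>v s (\<rho> j)"] \<rho>n D(1)
    by (metis smult_carrier_vec)
  have zero: "0 \<cdot>\<^sub>v s a = 0\<^sub>v n" if "a < n" for a by (rule zero_smult_vec[OF D(1)[OF that]])
  have "A * A = B"
  proof (rule mat_eq_if_eq_on_basis[OF sys])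
    fix j assume j: "j < n"
    have "(A * A) *\<^sub>v s j = complex_of_real (\<alpha> j * \<alpha> (\<rho> j)) \<cdot>\<^sub>v s (\<rho> (\<rho> j))"
      using A(1) A(2)[OF j] A(2)[OF \<rho>n[OF j]] D(1)[OF j] D(1)[OF \<rho>n[OF j]]
      by (simp add: assoc_mult_mat_vec[of _ n n _ n] mult_mat_vec[of _ n n] smult_smult_assoc)
    also have "\<dots> = complex_of_real (\<delta> j) \<cdot>\<^sub>v s (\<pi> j)"
      using j
    proof (rule cases)
      assume "j \<in> ?F"
      then show ?thesis by (simp add: top mid FD)
    next
      fix k assume k: "k \<in> ?F" "j = \<phi> k"
      then show ?thesis
        using k zero[OF \<rho>n[OF \<rho>n[OF j]]] zero[OF D(2)[OF j]]
        by (simp add: top mid bot PD) 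
    next
      fix k assume k: "k \<in> ?F" "j = \<pi> k"
      then show ?thesis
        using k zero[OF \<rho>n[OF \<rho>n[OF j]]] zero[OF D(2)[OF j]]
        by (simp add: bot FD)
    next
      assume "\<pi> j = j" "\<rho> j = j" "\<alpha> j = sqrt (\<delta> j)"
      then show ?thesis using nonneg[OF j] by (simp flip: of_real_mult)
    qed
    finally show "(A * A) *\<^sub>v s j = B *\<^sub>v s j" using D(10)[OF j] by simp
  qed (use A B in auto)
  moreover have "H_selfadjoint H A"
  proof (rule H_selfadjoint_if_on_basis[OF sys A(1)])
    fix i j assume i: "i < n" and j: "j < n"
    have l: "\<lblot>A *\<^sub>v s j, s i\<rblot> = (if \<rho> j = \<pi> i then complex_of_real (\<alpha> j * \<sigma> i) else 0)"
      using A(2)[OF j] D(1)[OF \<rho>n[OF j]] D(1)[OF i] D(11)[OF \<rho>n[OF j] i] by (simp add: form_linear)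
    have r: "\<lblot>s j, A *\<^sub>v s i\<rblot> = (if j = \<pi> (\<rho> i) then complex_of_real (\<alpha> i * \<sigma> (\<rho> i)) else 0)"
      using A(2)[OF i] D(1)[OF \<rho>n[OF i]] D(1)[OF j] D(11)[OF j \<rho>n[OF i]] by (simp add: form_linear)
    have inj: "\<pi> a = \<pi> b \<longleftrightarrow> a = b" if "a < n" "b < n" for a b using that D(3) by metis
    have sym: "\<alpha> q = \<alpha> p \<and> \<rho> p = \<pi> q \<and> \<sigma> p = \<sigma> q"
      if p: "p < n" and q: "q < n" and rel: "\<alpha> q \<noteq> 0" "\<rho> q = \<pi> p" for p q
      using q
    proof (rule cases)
      assume F: "q \<in> ?F"
      then have "p = \<phi> q" using rel inj[OF PD(1)[OF F] p] PD(2)[OF F] by (simp add: top)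
      then show ?thesis using F PD[OF F] FD[OF F] by (simp add: top mid)
    next
      fix k assume k: "k \<in> ?F" "q = \<phi> k"
      then have "p = k" using rel inj[OF FD(1)[OF k(1)] p] by (simp add: mid)
      then show ?thesis using k PD[OF k(1)] FD[OF k(1)] by (simp add: top mid)
    next
      fix k assume "k \<in> ?F" "q = \<pi> k"
      then show ?thesis using rel bot by simp
    next
      assume *: "\<pi> q = q" "\<rho> q = q" "\<alpha> q = sqrt (\<delta> q)"
      then have "p = q" using rel inj[OF p q] by simp
      then show ?thesis using * by simp
    qed
    show "\<lblot>A *\<^sub>v s j, s i\<rblot> = \<lblot>s j, A *\<^sub>v s i\<rblot>"
    proof (cases "\<alpha> j \<noteq> 0 \<and> \<rho> j = \<pi> i")
      case True
      then show ?thesis using l r sym[OF i j] D(3,4)[OF j] by auto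
    next
      case False
      have "\<not> (\<alpha> i \<noteq> 0 \<and> j = \<pi> (\<rho> i))"
      proof
        assume *: "\<alpha> i \<noteq> 0 \<and> j = \<pi> (\<rho> i)"
        then have "\<rho> i = \<pi> j" using D(3)[OF \<rho>n[OF i]] by simp
        then show False using sym[OF j i] * False by metis
      qed
      then show ?thesis using l r False by auto
    qed
  qed
  ultimately show ?thesis using A(1) by blast
qed

section \<open>Canonical bases and canonical forms\<close>

lemma index_gram_mat:
  assumes S: "S \<in> carrier_mat n k" and ij: "i < k" "j < k"
  shows "(mat_adjoint S * H * S) $$ (i, j) = \<lblot>col S j, col S i\<rblot>"
proof -
  have S': "mat_adjoint S \<in> carrier_mat k n" by (rule mat_adjoint_carrier[OF S])
  have "(mat_adjoint S * H * S) $$ (i, j) = (mat_adjoint S * (H * S)) $$ (i, j)"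
    by (simp only: assoc_mult_mat[OF S' H S])
  also have "\<dots> = row (mat_adjoint S) i \<bullet> (H *\<^sub>v col S j)"
    using S S' H ij col_mult2[OF H S ij(2)] by (subst index_mult_mat(1)) auto
  also have "\<dots> = \<lblot>col S j, col S i\<rblot>"
    using S S' H ij
    by (auto simp: indef_inner_def scalar_prod_def index_mat_adjoint mult.commute intro!: sum.cong)
  finally show ?thesis .
qed

text \<open>
  Comparing columns in \<open>B S = S J\<close> and entries of \<open>S\<^sup>* H S\<close> turns the matrix conditions into conditions on
  the columns of \<open>S\<close>.
\<close>

lemma canonical_form_imp_system:
  assumes cf: "canonical_form H B S ps ns es t" and bs: "bs = block_list ps ns es"
  shows "n = length bs + 2 * t"
    and "canonical_system n (col S) (pair_swap (length bs)) (block_signs bs) (block_weights bs)"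
proof -
  let ?N = "length bs + 2 * t" and ?\<pi> = "pair_swap (length bs)"
  let ?J = "mat ?N ?N (\<lambda>(i, j). if i = ?\<pi> j then complex_of_real (block_weights bs j) else 0)"
  have ps: "\<forall>l\<in>set ps. l > 0" and ns: "\<forall>l\<in>set ns. l < 0" and es: "set es \<subseteq> {1, -1}"
    using cf by (auto simp: canonical_form_def)
  obtain T where w: "similar_mat_wit ?J B T S"
    using cf unfolding canonical_form_def jordan_matrix_explicit[OF bs] by blast
  then show N: "n = ?N"
    using B by (auto simp: similar_mat_wit_def Let_def)
  have J: "?J \<in> carrier_mat n n" using N by simp
  note w = similar_mat_witD2[OF J w]
  have S: "S \<in> carrier_mat n n" and T: "T \<in> carrier_mat n n" using w by auto
  have "S * ?J = S * (T * (B * S))" using w S T B by (simp add: assoc_mult_mat[of _ n n _ n _ n])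
  also have "\<dots> = (S * T) * (B * S)" using S T B by (subst assoc_mult_mat[of _ n n _ n _ n]) auto
  also have "\<dots> = B * S" using w S B by simp
  finally have BS: "B * S = S * ?J" by simp
  have gram: "\<lblot>col S j, col S i\<rblot> = (if i = ?\<pi> j then complex_of_real (block_signs bs j) else 0)"
    if "i < n" "j < n" for i j
    using cf index_gram_mat[OF S that] that N
    unfolding canonical_form_def gram_matrix_explicit[OF bs es] by auto
  have lt: "?\<pi> i < n" if "i < n" for i using that pair_swap_less N by simp
  have fixed: "i < length bs" if "?\<pi> i = i" for i using that by (simp add: pair_swap_fixed_iff)
  have bsD: "snd b \<in> {1, -1} \<and> 0 \<le> snd b * fst b" if "b \<in> set bs" for b
    using that ps ns es unfolding bs block_list_def by (auto intro: less_imp_le)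
  show "canonical_system n (col S) ?\<pi> (block_signs bs) (block_weights bs)"
  proof (rule canonical_systemI)
    fix i assume i: "i < n"
    show "?\<pi> i = i \<Longrightarrow> block_signs bs i \<in> {1, -1} \<and> 0 \<le> block_signs bs i * block_weights bs i"
      using bsD[of "bs ! i"] fixed[of i] by (auto simp: block_signs_def block_weights_def)
    show "block_signs bs (?\<pi> i) = block_signs bs i" by (rule block_signs_pair_swap)
    show "?\<pi> i \<noteq> i \<Longrightarrow> block_signs bs i = 1 \<and> (block_weights bs i = 0 \<and> block_weights bs (?\<pi> i) = 1 \<or>
        block_weights bs i = 1 \<and> block_weights bs (?\<pi> i) = 0)"
    proof -
      assume "?\<pi> i \<noteq> i"
      then obtain r where r: "i = length bs + r"
        using pair_swap_fixed_iff le_Suc_ex not_less by metis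
      have "block_weights bs (length bs + q) = real (q mod 2)"
        "block_weights bs (Suc (length bs + q)) = real (Suc q mod 2)" "block_signs bs (length bs + q) = 1" for q
        by (simp_all add: block_weights_def block_signs_def Suc_diff_le)
      then show ?thesis unfolding r pair_swap_add by (cases "even r") (auto elim!: oddE evenE)
    qed
    have "B *\<^sub>v col S i = col (S * ?J) i" using col_mult2[OF B S i] BS by simp
    also have "\<dots> = S *\<^sub>v col ?J i" by (rule col_mult2[OF S J i])
    also have "col ?J i = complex_of_real (block_weights bs i) \<cdot>\<^sub>v unit_vec n (?\<pi> i)"
      using i N lt[OF i] by (intro eq_vecI) auto
    also have "S *\<^sub>v \<dots> = complex_of_real (block_weights bs i) \<cdot>\<^sub>v col S (?\<pi> i)"
      by (rule mat_mult_smult_unit_vec[OF S lt[OF i]])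
    finally show "B *\<^sub>v col S i = complex_of_real (block_weights bs i) \<cdot>\<^sub>v col S (?\<pi> i)" .
  next
    fix i j assume ij: "i < n" "j < n"
    have "j = ?\<pi> i \<longleftrightarrow> i = ?\<pi> j" using pair_swap_involution by metis
    moreover have "block_signs bs (?\<pi> j) = block_signs bs j" by (rule block_signs_pair_swap)
    ultimately show "\<lblot>col S i, col S j\<rblot> = (if i = ?\<pi> j then complex_of_real (block_signs bs j) else 0)"
      using gram[OF ij(2,1)] by auto
  qed (use S lt in \<open>auto simp: pair_swap_involution\<close>)
qed

lemma canonical_formI:
  assumes signs: "\<forall>l\<in>set ps. l > 0" "\<forall>l\<in>set ns. l < 0" "set es \<subseteq> {1, -1}"
    and bs: "bs = block_list ps ns es" and N: "n = length bs + 2 * t"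
    and sys: "canonical_system n s (pair_swap (length bs)) (block_signs bs) (block_weights bs)"
  shows "canonical_form H B (system_mat n s) ps ns es t"
proof -
  let ?N = "length bs + 2 * t" and ?\<pi> = "pair_swap (length bs)"
  let ?J = "mat ?N ?N (\<lambda>(i, j). if i = ?\<pi> j then complex_of_real (block_weights bs j) else 0)"
  let ?K = "mat ?N ?N (\<lambda>(i, j). if i = ?\<pi> j then complex_of_real (block_signs bs j) else 0)"
  note D = canonical_systemD[OF sys]
  define S where "S = system_mat n s"
  have S: "S \<in> carrier_mat n n" by (simp add: S_def)
  have J: "?J \<in> carrier_mat n n" using N by simp
  have col: "col S j = s j" if "j < n" for j using that D(1)[OF that] by (simp add: S_def)
  obtain T where T: "T \<in> carrier_mat n n" "S * T = 1\<^sub>m n" "T * S = 1\<^sub>m n"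
    using system_mat_inverse[OF sys] unfolding S_def by blast
  have BS: "B * S = S * ?J"
  proof (rule mat_col_eqI)
    fix j assume "j < dim_col (S * ?J)"
    then have j: "j < n" using J N by simp
    have "col ?J j = complex_of_real (block_weights bs j) \<cdot>\<^sub>v unit_vec n (?\<pi> j)"
      using j N D(2)[OF j] by (intro eq_vecI) auto
    then have "col (S * ?J) j = complex_of_real (block_weights bs j) \<cdot>\<^sub>v col S (?\<pi> j)"
      using col_mult2[OF S J j] mat_mult_smult_unit_vec[OF S D(2)[OF j]] by simp
    then show "col (B * S) j = col (S * ?J) j"
      using col_mult2[OF B S j] col[OF j] col[OF D(2)[OF j]] D(10)[OF j] by simp
  qed (use B S N in auto)
  have "T * B * S = T * (S * ?J)" using T B S BS by (simp add: assoc_mult_mat[of _ n n _ n _ n])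
  also have "\<dots> = (T * S) * ?J" using T S J by (subst assoc_mult_mat[of _ n n _ n _ n]) auto
  also have "\<dots> = ?J" unfolding T(3) by (rule left_mult_one_mat[OF J])
  finally have "?J = T * B * S" by simp
  then have w: "similar_mat_wit ?J B T S"
    using J B T S N by (auto simp: similar_mat_wit_def Let_def)
  have gram: "mat_adjoint S * H * S = ?K"
  proof (rule eq_matI)
    fix i j assume "i < dim_row ?K" "j < dim_col ?K"
    then have ij: "i < n" "j < n" using N by auto
    have "\<lblot>s j, s i\<rblot> = (if i = ?\<pi> j then complex_of_real (block_signs bs j) else 0)"
      using D(11)[OF ij(2,1)] D(3,4)[OF ij(1)] D(3,4)[OF ij(2)] by auto
    then show "(mat_adjoint S * H * S) $$ (i, j) = ?K $$ (i, j)"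
      using index_gram_mat[OF S ij] col ij N by simp
  qed (use S mat_adjoint_carrier[OF S] N in auto)
  show ?thesis
    unfolding canonical_form_def jordan_matrix_explicit[OF bs] gram_matrix_explicit[OF bs signs(3)]
    using signs w gram unfolding S_def by blast
qed

lemma card_positive_kernel_indices_block_list:
  assumes bs: "bs = block_list ps ns es" and N: "n = length bs + 2 * t"
    and signs: "\<forall>l\<in>set ps. l > 0" "\<forall>l\<in>set ns. l < 0" "set es \<subseteq> {1, -1}"
  shows "card (positive_kernel_indices (pair_swap (length bs)) (block_signs bs) (block_weights bs)) =
    count_list es 1"
proof -
  let ?P = "\<lambda>b :: real \<times> real. fst b = 0 \<and> snd b = 1"
  have "positive_kernel_indices (pair_swap (length bs)) (block_signs bs) (block_weights bs) =
      {i. i < length bs \<and> ?P (bs ! i)}"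
    unfolding positive_kernel_indices_def using N by (auto simp: pair_swap_fixed_iff block_signs_def block_weights_def)
  then have "card (positive_kernel_indices (pair_swap (length bs)) (block_signs bs) (block_weights bs)) =
      length (filter ?P bs)"
    by (simp add: length_filter_conv_card)
  also have "filter ?P bs = filter ?P (map (\<lambda>e. (0, Re e)) es)"
    unfolding bs block_list_def using signs(1,2) by (auto simp: filter_empty_conv)
  also have "length \<dots> = length (filter ((=) 1) es)"
    using signs(3) by (induction es) auto
  also have "\<dots> = count_list es 1" by (simp add: count_list_eq_length_filter)
  finally show ?thesis .
qed

lemma card_chain_top_indices_block_list:
  assumes N: "n = length bs + 2 * t"
  shows "card (chain_top_indices (pair_swap (length bs)) (block_weights bs)) = t"
proof -
  have "chain_top_indices (pair_swap (length bs)) (block_weights bs) =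
      (\<lambda>l. length bs + (2 * l + 1)) ` {..<t}"
  proof (intro equalityI subsetI)
    fix i assume "i \<in> chain_top_indices (pair_swap (length bs)) (block_weights bs)"
    then have i: "length bs \<le> i" "i < length bs + 2 * t" "(i - length bs) mod 2 = 1"
      unfolding chain_top_indices_def using N
      by (auto simp: pair_swap_fixed_iff block_weights_def split: if_splits)
    from i(3) have "odd (i - length bs)" by (simp only: odd_iff_mod_2_eq_one)
    then obtain l where "i - length bs = 2 * l + 1" by (rule oddE)
    then have "i = length bs + (2 * l + 1)" "l < t" using i by auto
    then show "i \<in> (\<lambda>l. length bs + (2 * l + 1)) ` {..<t}" by blast
  next
    fix i assume "i \<in> (\<lambda>l. length bs + (2 * l + 1)) ` {..<t}"
    then show "i \<in> chain_top_indices (pair_swap (length bs)) (block_weights bs)"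
      unfolding chain_top_indices_def using N by (auto simp: pair_swap_fixed_iff block_weights_def)
  qed
  then show ?thesis by (simp add: card_image inj_on_def)
qed

lemma canonical_form_cards:
  assumes sys: "canonical_system n s \<pi> \<sigma> \<delta>" and cf: "canonical_form H B S ps ns es t"
  shows "count_list es 1 = card (positive_kernel_indices \<pi> \<sigma> \<delta>)"
    and "t = card (chain_top_indices \<pi> \<delta>)"
proof -
  define bs where "bs = block_list ps ns es"
  note F = canonical_form_imp_system[OF cf bs_def]
  have signs: "\<forall>l\<in>set ps. l > 0" "\<forall>l\<in>set ns. l < 0" "set es \<subseteq> {1, -1}"
    using cf by (auto simp: canonical_form_def)
  show "count_list es 1 = card (positive_kernel_indices \<pi> \<sigma> \<delta>)"
    using card_positive_kernel_indices_le[OF sys F(2)] card_positive_kernel_indices_le[OF F(2) sys]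
      card_positive_kernel_indices_block_list[OF bs_def F(1) signs] by simp
  show "t = card (chain_top_indices \<pi> \<delta>)"
    using card_chain_top_indices_le[OF sys F(2)] card_chain_top_indices_le[OF F(2) sys]
      card_chain_top_indices_block_list[OF F(1)] by simp
qed

lemma canonical_system_reindex:
  assumes sys: "canonical_system n s \<pi> \<sigma> \<delta>" and f: "bij_betw f {..<n} {..<n}"
    and \<pi>': "\<And>j. j < n \<Longrightarrow> \<pi>' j < n" "\<And>j. j < n \<Longrightarrow> \<pi> (f j) = f (\<pi>' j)"
    and \<sigma>': "\<And>j. j < n \<Longrightarrow> \<sigma>' j = \<sigma> (f j)" and \<delta>': "\<And>j. j < n \<Longrightarrow> \<delta>' j = \<delta> (f j)"
  shows "canonical_system n (\<lambda>j. s (f j)) \<pi>' \<sigma>' \<delta>'"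
proof -
  have fn: "f j < n" if "j < n" for j using f that by (auto dest: bij_betwE)
  have inj: "f i = f j \<longleftrightarrow> i = j" if "i < n" "j < n" for i j
    using f that by (auto simp: bij_betw_def inj_on_def)
  note D = canonical_systemD[OF sys fn]
  have inv: "\<pi>' (\<pi>' j) = j" if "j < n" for j
    using D(3)[OF that] \<pi>' that inj by metis
  show ?thesis
  proof (rule canonical_systemI)
    fix i assume i: "i < n"
    have fixed: "\<pi> (f i) = f i \<longleftrightarrow> \<pi>' i = i" using \<pi>' i inj by metis
    show "\<pi>' i = i \<Longrightarrow> \<sigma>' i \<in> {1, -1} \<and> 0 \<le> \<sigma>' i * \<delta>' i"
      using D(5,8)[OF i] fixed \<sigma>' \<delta>' i by auto
    show "\<pi>' i \<noteq> i \<Longrightarrow> \<sigma>' i = 1 \<and> (\<delta>' i = 0 \<and> \<delta>' (\<pi>' i) = 1 \<or> \<delta>' i = 1 \<and> \<delta>' (\<pi>' i) = 0)"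
      using D(6,7)[OF i] fixed \<sigma>' \<delta>' \<pi>' i by auto
  qed (use D(1,4,10,11) \<pi>' \<sigma>' \<delta>' inv inj fn in auto)
qed

text \<open>
  A canonical basis is reordered by listing the indices of the fixed points by the sign of their
  eigenvalue, followed by the pairs \<open>\<pi> i, i\<close> for the tops \<open>i\<close> of chains.
\<close>

theorem canonical_form_exists: "\<exists>S ps ns es t. canonical_form H B S ps ns es t"
proof -
  obtain s \<pi> \<sigma> \<delta> where sys: "canonical_system n s \<pi> \<sigma> \<delta>" using canonical_basis_exists by blast
  note D = canonical_systemD[OF sys]
  define I\<^sub>p where "I\<^sub>p = filter (\<lambda>i. \<pi> i = i \<and> \<delta> i > 0) [0..<n]"
  define I\<^sub>n where "I\<^sub>n = filter (\<lambda>i. \<pi> i = i \<and> \<delta> i < 0) [0..<n]"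
  define I\<^sub>0 where "I\<^sub>0 = filter (\<lambda>i. \<pi> i = i \<and> \<delta> i = 0) [0..<n]"
  define I\<^sub>2 where "I\<^sub>2 = filter (\<lambda>i. \<pi> i \<noteq> i \<and> \<delta> i = 1) [0..<n]"
  define I where "I = I\<^sub>p @ I\<^sub>n @ I\<^sub>0"
  define L where "L = I @ concat (map (\<lambda>i. [\<pi> i, i]) I\<^sub>2)"
  define ps where "ps = map \<delta> I\<^sub>p"
  define ns where "ns = map \<delta> I\<^sub>n"
  define es where "es = map (\<lambda>i. complex_of_real (\<sigma> i)) I\<^sub>0"
  define t where "t = length I\<^sub>2"
  define bs where "bs = block_list ps ns es"
  have bs: "bs = map (\<lambda>i. (\<delta> i, \<sigma> i)) I"
  proof -
    have "\<sigma> i = 1" if "i \<in> set I\<^sub>p" for i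
      using that D(5,8)[of i] by (auto simp: I\<^sub>p_def)
    moreover have "\<sigma> i = -1" if "i \<in> set I\<^sub>n" for i
      using that D(5,8)[of i] by (auto simp: I\<^sub>n_def)
    moreover have "\<delta> i = 0" if "i \<in> set I\<^sub>0" for i using that by (simp add: I\<^sub>0_def)
    ultimately show ?thesis
      by (simp add: bs_def block_list_def ps_def ns_def es_def I_def)
  qed
  have fixed: "\<pi> i = i" if "i \<in> set I" for i
    using that by (auto simp: I_def I\<^sub>p_def I\<^sub>n_def I\<^sub>0_def)
  have top: "i < n" "\<pi> i \<noteq> i" "\<delta> i = 1" "\<delta> (\<pi> i) = 0" "\<sigma> i = 1" if "i \<in> set I\<^sub>2" for i
    using that D(6,7)[of i] by (auto simp: I\<^sub>2_def)
  have lenL: "length L = length bs + 2 * t"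
    by (simp add: L_def bs t_def length_concat comp_def sum_list_triv)
  have setL: "set L = {..<n}"
  proof (intro equalityI subsetI)
    fix i assume i: "i \<in> {..<n}"
    show "i \<in> set L"
    proof (cases "\<pi> i = i")
      case True
      then show ?thesis using i by (auto simp: L_def I_def I\<^sub>p_def I\<^sub>n_def I\<^sub>0_def)
    next
      case False
      then have "i \<in> set I\<^sub>2 \<or> \<pi> i \<in> set I\<^sub>2"
        using i D(2,3,7)[of i] by (auto simp: I\<^sub>2_def)
      then show ?thesis using i D(3)[of i] by (fastforce simp: L_def)
    qed
  next
    fix i assume "i \<in> set L"
    then show "i \<in> {..<n}" using D(2)
      by (auto simp: L_def I_def I\<^sub>p_def I\<^sub>n_def I\<^sub>0_def I\<^sub>2_def)
  qed
  have distL: "distinct L"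
  proof -
    have "distinct I" by (auto simp: I_def I\<^sub>p_def I\<^sub>n_def I\<^sub>0_def)
    moreover have "distinct (concat (map (\<lambda>i. [\<pi> i, i]) I\<^sub>2))"
    proof (rule distinct_concat_pairs)
      show "distinct I\<^sub>2" by (simp add: I\<^sub>2_def)
      show "inj_on \<pi> (set I\<^sub>2)" using D(3) top(1) by (metis inj_on_inverseI)
      have "\<delta> (\<pi> i) \<noteq> \<delta> j" if "i \<in> set I\<^sub>2" "j \<in> set I\<^sub>2" for i j
        using top(4)[OF that(1)] top(3)[OF that(2)] by simp
      then show "\<pi> ` set I\<^sub>2 \<inter> set I\<^sub>2 = {}" by blast
    qed
    moreover have "i \<notin> set I \<and> \<pi> i \<notin> set I" if "i \<in> set I\<^sub>2" for i
      using fixed[of i] fixed[of "\<pi> i"] top(1,2)[OF that] D(3)[of i] by auto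
    ultimately show ?thesis by (auto simp: L_def)
  qed
  have N: "n = length bs + 2 * t"
    using distinct_card[OF distL] setL lenL by simp
  have lt: "pair_swap (length bs) j < n" if "j < n" for j using that pair_swap_less N by simp
  have f: "bij_betw ((!) L) {..<n} {..<n}"
    using bij_betw_nth[OF distL] lenL N setL by simp
  have low: "L ! j = I ! j" "bs ! j = (\<delta> (I ! j), \<sigma> (I ! j))" "I ! j \<in> set I" if "j < length bs" for j
    using that by (auto simp: L_def bs nth_append)
  have even: "L ! (length bs + 2 * l) = \<pi> (I\<^sub>2 ! l)"
    and odd: "L ! Suc (length bs + 2 * l) = I\<^sub>2 ! l" if "l < t" for l
    using that nth_concat_pairs[of l I\<^sub>2 \<pi> "\<lambda>i. i"]
    by (auto simp: L_def bs nth_append t_def simp flip: add_Suc_right)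
  have cases: thesis if "j < n" "j < length bs \<Longrightarrow> thesis"
    "\<And>l. l < t \<Longrightarrow> j = length bs + 2 * l \<Longrightarrow> thesis"
    "\<And>l. l < t \<Longrightarrow> j = Suc (length bs + 2 * l) \<Longrightarrow> thesis" for j thesis
  proof (cases "j < length bs")
    case False
    have "j - length bs = 2 * ((j - length bs) div 2) \<or> j - length bs = Suc (2 * ((j - length bs) div 2))"
      by presburger
    then show thesis using False that(1) N that(3,4)[of "(j - length bs) div 2"] by fastforce
  qed (use that in blast)
  have "canonical_system n (\<lambda>j. s (L ! j)) (pair_swap (length bs)) (block_signs bs) (block_weights bs)"
  proof (rule canonical_system_reindex[OF sys f lt])
    fix j assume j: "j < n"
    have mem: "I\<^sub>2 ! l \<in> set I\<^sub>2" if "l < t" for l using that by (simp add: t_def)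
    show "\<pi> (L ! j) = L ! pair_swap (length bs) j"
      using j by (rule cases) (auto simp: low fixed even odd pair_swap_def D(3) top(1)[OF mem])
    show "block_signs bs j = \<sigma> (L ! j)"
      using j by (rule cases) (auto simp: low even odd block_signs_def D(4) top[OF mem])
    show "block_weights bs j = \<delta> (L ! j)"
      using j by (rule cases) (auto simp: low even odd block_weights_def top[OF mem])
  qed
  moreover have sign: "complex_of_real (\<sigma> i) \<in> {1, -1}" if "i < n" for i using D(8)[OF that] by auto
  have "\<forall>l\<in>set ps. l > 0" "\<forall>l\<in>set ns. l < 0" "set es \<subseteq> {1, -1}"
    using sign by (auto simp: ps_def ns_def es_def I\<^sub>p_def I\<^sub>n_def I\<^sub>0_def)
  ultimately show ?thesis using canonical_formI[OF _ _ _ bs_def N] by blast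
qed

lemma s_plus_eq_card:
  assumes sys: "canonical_system n s \<pi> \<sigma> \<delta>"
  shows "s_plus H B = card (positive_kernel_indices \<pi> \<sigma> \<delta>)"
  unfolding s_plus_def using canonical_form_exists canonical_form_cards(1)[OF sys]
  by (intro the_equality) metis+

lemma t_blocks_eq_card:
  assumes sys: "canonical_system n s \<pi> \<sigma> \<delta>"
  shows "t_blocks H B = card (chain_top_indices \<pi> \<delta>)"
  unfolding t_blocks_def using canonical_form_exists canonical_form_cards(2)[OF sys]
  by (intro the_equality) metis+

lemma weights_nonneg_if_spectrum_nonneg:
  assumes sys: "canonical_system n s \<pi> \<sigma> \<delta>" and spec: "spectrum B \<subseteq> complex_of_real ` {0..}"
    and i: "i < n"
  shows "0 \<le> \<delta> i"
proof (cases "\<pi> i = i")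
  case True
  note D = canonical_systemD[OF sys i]
  have "s i \<noteq> 0\<^sub>v n"
  proof
    assume "s i = 0\<^sub>v n"
    then have "\<lblot>s i, s i\<rblot> = 0" using D(1) by (metis form_zero_left)
    then show False using D(11)[OF i] True D(8) by auto
  qed
  then have "complex_of_real (\<delta> i) \<in> spectrum B"
    using D(1,10) True B unfolding spectrum_def eigenvalue_def eigenvector_def by auto
  then show ?thesis using spec by auto
next
  case False
  then show ?thesis using canonical_systemD(7)[OF sys i] by auto
qed

end

section \<open>The criterion for square roots\<close>

theorem theorem4p1:
  fixes H B :: "complex mat" and n :: nat
  assumes "H \<in> carrier_mat n n" and "invertible_mat H" and "mat_adjoint H = H"
    and "B \<in> carrier_mat n n" and "H_nonnegative H B"
  shows "(\<exists>A. H_selfadjoint_sqrt H B A) \<longleftrightarrow>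
    spectrum B \<subseteq> complex_of_real ` {0..} \<and> s_plus H B \<ge> t_blocks H B"
proof -
  interpret nonnegative_operator n H B by unfold_locales (use assms in auto)
  obtain s \<pi> \<sigma> \<delta> where sys: "canonical_system n s \<pi> \<sigma> \<delta>" using canonical_basis_exists by blast
  have sqrt_iff: "H_selfadjoint_sqrt H B A \<longleftrightarrow> A \<in> carrier_mat n n \<and> H_selfadjoint H A \<and> A * A = B" for A
    using assms(4) by (auto simp: H_selfadjoint_sqrt_def)
  show ?thesis
    unfolding sqrt_iff s_plus_eq_card[OF sys] t_blocks_eq_card[OF sys]
    using square_root_imp_spectrum_nonneg square_root_imp_card_le[OF _ _ _ sys]
      square_root_exists[OF sys weights_nonneg_if_spectrum_nonneg[OF sys]] by blast
qed

end
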